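(* Let $R$ be a countable integral domain with quotient field $K$, with $\mathrm{Jac}(R) = (0)$ and $R^\times\neq R^*$. Let $E$ be the semilattice of idempotents of $S = I_l(R\rtimes R^\times)$. Then the transformation groupoid $(K\rtimes K^\times)\ltimes\widehat{E}$ is purely infinite.
   Context: $R^\times = R\setminus\{0\}$, $R^*$ is the group of units of $R$, $\mathrm{Jac}(R)$ is the Jacobson radical, $K^\times=K\setminus\{0\}$. The $ax+b$-semigroup $R\rtimes R^\times$ is the set $R\times R^\times$ with product $(b,a)(d,c) = (b+ad,ac)$, viewed as a subsemigroup of the group $K\rtimes K^\times$ (defined by the same formula). For a subsemigroup $P$ of a group $G$ (here $P=R\rtimes R^\times$, $G=K\rtimes K^\times$): $S = I_l(P)$ is the inverse semigroup of partial bijections of $P$ generated by the maps $p : P \to pP$, $x\mapsto px$ ($p \in P$), together with the empty map $0$. Its semilattice of idempotents $E$ is identified with the set $\mathcal{J} = \{p_1^{-1}q_1\cdots p_n^{-1}q_nP : p_i,q_i\in P\}\cup\{\emptyset\}$ of constructible right ideals of $P$ under intersection (here $qX=\{qx : x\in X\}$, $p^{-1}X = \{y \in P : py\in X\}$). Put $S^\times = S\setminus\{0\}$; for $s \in S^\times$ there is a unique $\sigma(s)\in G$ with $s(x) = \sigma(s)x$ for all $x$ in the domain of $s$. $\widehat{E}$ is the space of non-zero maps $\chi : \mathcal{J}\to\{0,1\}$ with $\chi(X\cap Y) = \chi(X)\chi(Y)$ and $\chi(\emptyset) = 0$, with the topology of pointwise convergence. $G$ acts partially on $\widehat{E}$: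 $g\in G$ has domain $U_{g^{-1}} = \{\chi : \chi(\mathrm{dom}(s)) = 1 \text{ for some } s\in S^\times \text{ with } \sigma(s) = g\}$, and $(g.\chi)(X) = \chi(s^{-1}(X\cap\mathrm{im}(s)))$ for such $s$. The transformation groupoid is $G\ltimes\widehat{E} = \{(g,\chi)\in G\times\widehat{E} : \chi\in U_{g^{-1}}\}$ ($G$ discrete, subspace topology), $s(g,\chi) = \chi$, $r(g,\chi) = g.\chi$, $(g_1,g_2.\chi)(g_2,\chi) = (g_1g_2,\chi)$, $(g,\chi)^{-1}=(g^{-1},g.\chi)$. An étale groupoid $\mathcal{G}$ with totally disconnected unit space is purely infinite (in the sense of Matui) if for every compact open set $A\subseteq\mathcal{G}^{(0)}$ there exist compact open bisections $U,V\subseteq\mathcal{G}$ with $s(U) = s(V) = A$, $r(U)\cup r(V)\subseteq A$ and $r(U)\cap r(V) = \emptyset$. *)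

theory Defs
  imports
    "HOL-Algebra.Ideal"
    "HOL-Computational_Algebra.Fraction_Field"
    "HOL-Analysis.Analysis"
begin

section \<open>Integral domains and the \<open>ax + b\<close>-semigroup\<close>

definition ring_of_class :: "'a::comm_ring_1 ring" where
  "ring_of_class = \<lparr>carrier = UNIV, monoid.mult = (*), one = 1, zero = 0, add = (+)\<rparr>"

definition jacobson_radical :: "'a::comm_ring_1 set" where
  "jacobson_radical = \<Inter> {M. maximalideal M ring_of_class}"

text \<open>In a pair \<open>(b, a)\<close> the additive part comes first, as in \<open>K \<rtimes> K\<^sup>\<times>\<close>.\<close>

definition axb_group :: "('k::field \<times> 'k) monoid" where
  "axb_group = \<lparr>carrier = UNIV \<times> {a. a \<noteq> 0},
     monoid.mult = (\<lambda>(b, a) (d, c). (b + a * d, a * c)), one = (0, 1)\<rparr>"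

text \<open>\<open>R \<rtimes> R\<^sup>\<times>\<close> as a subsemigroup of \<open>K \<rtimes> K\<^sup>\<times>\<close>, where \<open>R\<close> is embedded into \<open>K\<close> by \<open>b \<mapsto> b/1\<close>.\<close>

definition axb_semigroup :: "('a::idom fract \<times> 'a fract) set" where
  "axb_semigroup = {(Fraction_Field.Fract b 1, Fraction_Field.Fract a 1) | b a. a \<noteq> 0}"


section \<open>The left inverse hull of a subsemigroup of a group\<close>

text \<open>Partial bijections are represented by their graphs. Hence the inverse of \<open>s\<close> is the converse
  relation, the product \<open>s t\<close> (first \<open>t\<close>, then \<open>s\<close>) is \<open>t O s\<close>, and the empty map is the empty
  relation.\<close>

inductive_set left_inverse_hull :: "('g, 'm) monoid_scheme \<Rightarrow> 'g set \<Rightarrow> ('g \<times> 'g) set set"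
  for G :: "('g, 'm) monoid_scheme" and P :: "'g set" where
  zero: "{} \<in> left_inverse_hull G P"
| transl: "p \<in> P \<Longrightarrow> {(x, p \<otimes>\<^bsub>G\<^esub> x) | x. x \<in> P} \<in> left_inverse_hull G P"
| inverse: "s \<in> left_inverse_hull G P \<Longrightarrow> s\<inverse> \<in> left_inverse_hull G P"
| comp: "s \<in> left_inverse_hull G P \<Longrightarrow> t \<in> left_inverse_hull G P \<Longrightarrow> t O s \<in> left_inverse_hull G P"

definition left_translate :: "('g, 'm) monoid_scheme \<Rightarrow> 'g \<Rightarrow> 'g set \<Rightarrow> 'g set" where
  "left_translate G q X = {q \<otimes>\<^bsub>G\<^esub> x | x. x \<in> X}"

definition left_preimage :: "('g, 'm) monoid_scheme \<Rightarrow> 'g set \<Rightarrow> 'g \<Rightarrow> 'g set \<Rightarrow> 'g set" where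
  "left_preimage G P p X = {y \<in> P. p \<otimes>\<^bsub>G\<^esub> y \<in> X}"

text \<open>Starting from \<open>P\<close> itself adds nothing, since \<open>P = p\<inverse>pP\<close>.\<close>

inductive_set constructible_ideals :: "('g, 'm) monoid_scheme \<Rightarrow> 'g set \<Rightarrow> 'g set set"
  for G :: "('g, 'm) monoid_scheme" and P :: "'g set" where
  empty: "{} \<in> constructible_ideals G P"
| whole: "P \<in> constructible_ideals G P"
| step: "X \<in> constructible_ideals G P \<Longrightarrow> p \<in> P \<Longrightarrow> q \<in> P \<Longrightarrow>
    left_preimage G P p (left_translate G q X) \<in> constructible_ideals G P"

definition hull_idempotents :: "('g, 'm) monoid_scheme \<Rightarrow> 'g set \<Rightarrow> ('g \<times> 'g) set set" where
  "hull_idempotents G P = {e \<in> left_inverse_hull G P. e O e = e}"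

definition grading :: "('g, 'm) monoid_scheme \<Rightarrow> ('g \<times> 'g) set \<Rightarrow> 'g" where
  "grading G s = (THE g. g \<in> carrier G \<and> (\<forall>(x, y) \<in> s. y = g \<otimes>\<^bsub>G\<^esub> x))"


section \<open>The spectrum and the partial action\<close>

text \<open>Characters are extensional functions on the constructible ideals; by
  \<open>hull_idempotents_eq\<close> below these are the characters of the semilattice of idempotents.\<close>

definition characters :: "('g, 'm) monoid_scheme \<Rightarrow> 'g set \<Rightarrow> ('g set \<Rightarrow> nat) set" where
  "characters G P = {\<phi>. \<phi> \<in> constructible_ideals G P \<rightarrow>\<^sub>E {0, 1} \<and>
     (\<exists>X \<in> constructible_ideals G P. \<phi> X \<noteq> 0) \<and>
     (\<forall>X \<in> constructible_ideals G P. \<forall>Y \<in> constructible_ideals G P. \<phi> (X \<inter> Y) = \<phi> X * \<phi> Y) \<and>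
     \<phi> {} = 0}"

definition spectrum_topology ::
    "('g, 'm) monoid_scheme \<Rightarrow> 'g set \<Rightarrow> ('g set \<Rightarrow> nat) topology" where
  "spectrum_topology G P = subtopology
     (product_topology (\<lambda>X. discrete_topology {0, 1}) (constructible_ideals G P)) (characters G P)"

definition implements ::
    "('g, 'm) monoid_scheme \<Rightarrow> 'g set \<Rightarrow> ('g \<times> 'g) set \<Rightarrow> 'g \<Rightarrow> ('g set \<Rightarrow> nat) \<Rightarrow> bool" where
  "implements G P s g \<phi> \<longleftrightarrow>
     s \<in> left_inverse_hull G P - {{}} \<and> grading G s = g \<and> \<phi> (Domain s) = 1"

text \<open>The domain of the action of \<open>g\<close>, written \<open>U\<^bsub>g\<inverse>\<^esub>\<close> in the usual notation for partial actions.\<close>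

definition action_domain ::
    "('g, 'm) monoid_scheme \<Rightarrow> 'g set \<Rightarrow> 'g \<Rightarrow> ('g set \<Rightarrow> nat) set" where
  "action_domain G P g = {\<phi> \<in> characters G P. \<exists>s. implements G P s g \<phi>}"

text \<open>The value does not depend on the choice of \<open>s\<close>, see \<open>action_eq\<close> below.\<close>

definition action ::
    "('g, 'm) monoid_scheme \<Rightarrow> 'g set \<Rightarrow> 'g \<Rightarrow> ('g set \<Rightarrow> nat) \<Rightarrow> ('g set \<Rightarrow> nat)" where
  "action G P g \<phi> = (let s = (SOME s. implements G P s g \<phi>) in
     (\<lambda>X \<in> constructible_ideals G P. \<phi> (s\<inverse> `` (X \<inter> Range s))))"


section \<open>Etale groupoids and pure infiniteness\<close>

text \<open>The unit space is a separate type, embedded into the arrows by \<open>unit_arrow\<close>.\<close>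

record ('a, 'x) groupoid =
  arrows :: "'a topology"
  unit_space :: "'x topology"
  source :: "'a \<Rightarrow> 'x"
  range_map :: "'a \<Rightarrow> 'x"
  compose_arrows :: "'a \<Rightarrow> 'a \<Rightarrow> 'a"
  inverse_arrow :: "'a \<Rightarrow> 'a"
  unit_arrow :: "'x \<Rightarrow> 'a"

definition local_homeomorphism :: "'a topology \<Rightarrow> 'b topology \<Rightarrow> ('a \<Rightarrow> 'b) \<Rightarrow> bool" where
  "local_homeomorphism X Y f \<longleftrightarrow> (\<forall>x \<in> topspace X. \<exists>U. openin X U \<and> x \<in> U \<and> openin Y (f ` U) \<and>
     homeomorphic_map (subtopology X U) (subtopology Y (f ` U)) f)"

locale etale_groupoid =
  fixes \<G> :: "('a, 'x) groupoid"
  assumes source_closed: "g \<in> topspace (arrows \<G>) \<Longrightarrow> source \<G> g \<in> topspace (unit_space \<G>)"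
    and range_closed: "g \<in> topspace (arrows \<G>) \<Longrightarrow> range_map \<G> g \<in> topspace (unit_space \<G>)"
    and unit_closed: "x \<in> topspace (unit_space \<G>) \<Longrightarrow> unit_arrow \<G> x \<in> topspace (arrows \<G>)"
    and source_unit: "x \<in> topspace (unit_space \<G>) \<Longrightarrow> source \<G> (unit_arrow \<G> x) = x"
    and range_unit: "x \<in> topspace (unit_space \<G>) \<Longrightarrow> range_map \<G> (unit_arrow \<G> x) = x"
    and compose_closed: "\<lbrakk>g \<in> topspace (arrows \<G>); h \<in> topspace (arrows \<G>); source \<G> g = range_map \<G> h\<rbrakk>
      \<Longrightarrow> compose_arrows \<G> g h \<in> topspace (arrows \<G>)"
    and source_compose: "\<lbrakk>g \<in> topspace (arrows \<G>); h \<in> topspace (arrows \<G>); source \<G> g = range_map \<G> h\<rbrakk>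
      \<Longrightarrow> source \<G> (compose_arrows \<G> g h) = source \<G> h"
    and range_compose: "\<lbrakk>g \<in> topspace (arrows \<G>); h \<in> topspace (arrows \<G>); source \<G> g = range_map \<G> h\<rbrakk>
      \<Longrightarrow> range_map \<G> (compose_arrows \<G> g h) = range_map \<G> g"
    and compose_assoc: "\<lbrakk>g \<in> topspace (arrows \<G>); h \<in> topspace (arrows \<G>); k \<in> topspace (arrows \<G>);
        source \<G> g = range_map \<G> h; source \<G> h = range_map \<G> k\<rbrakk>
      \<Longrightarrow> compose_arrows \<G> (compose_arrows \<G> g h) k = compose_arrows \<G> g (compose_arrows \<G> h k)"
    and unit_compose: "g \<in> topspace (arrows \<G>) \<Longrightarrow>
      compose_arrows \<G> (unit_arrow \<G> (range_map \<G> g)) g = g"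
    and compose_unit: "g \<in> topspace (arrows \<G>) \<Longrightarrow>
      compose_arrows \<G> g (unit_arrow \<G> (source \<G> g)) = g"
    and inverse_closed: "g \<in> topspace (arrows \<G>) \<Longrightarrow> inverse_arrow \<G> g \<in> topspace (arrows \<G>)"
    and source_inverse: "g \<in> topspace (arrows \<G>) \<Longrightarrow> source \<G> (inverse_arrow \<G> g) = range_map \<G> g"
    and range_inverse: "g \<in> topspace (arrows \<G>) \<Longrightarrow> range_map \<G> (inverse_arrow \<G> g) = source \<G> g"
    and inverse_compose: "g \<in> topspace (arrows \<G>) \<Longrightarrow>
      compose_arrows \<G> (inverse_arrow \<G> g) g = unit_arrow \<G> (source \<G> g)"
    and compose_inverse: "g \<in> topspace (arrows \<G>) \<Longrightarrow>
      compose_arrows \<G> g (inverse_arrow \<G> g) = unit_arrow \<G> (range_map \<G> g)"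
    and continuous_compose: "continuous_map
      (subtopology (prod_topology (arrows \<G>) (arrows \<G>)) {(g, h). source \<G> g = range_map \<G> h})
      (arrows \<G>) (\<lambda>(g, h). compose_arrows \<G> g h)"
    and continuous_inverse: "continuous_map (arrows \<G>) (arrows \<G>) (inverse_arrow \<G>)"
    and continuous_unit: "continuous_map (unit_space \<G>) (arrows \<G>) (unit_arrow \<G>)"
    and hausdorff: "Hausdorff_space (arrows \<G>)"
    and locally_compact: "locally_compact_space (arrows \<G>)"
    and source_local_homeo: "local_homeomorphism (arrows \<G>) (unit_space \<G>) (source \<G>)"
    and range_local_homeo: "local_homeomorphism (arrows \<G>) (unit_space \<G>) (range_map \<G>)"

definition totally_disconnected :: "'x topology \<Rightarrow> bool" where
  "totally_disconnected X \<longleftrightarrow> (\<forall>C. connectedin X C \<longrightarrow> (\<exists>x. C \<subseteq> {x}))"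

definition compact_open :: "'x topology \<Rightarrow> 'x set \<Rightarrow> bool" where
  "compact_open X A \<longleftrightarrow> compactin X A \<and> openin X A"

definition bisection :: "('a, 'x) groupoid \<Rightarrow> 'a set \<Rightarrow> bool" where
  "bisection \<G> U \<longleftrightarrow> U \<subseteq> topspace (arrows \<G>) \<and> inj_on (source \<G>) U \<and> inj_on (range_map \<G>) U"

definition purely_infinite :: "('a, 'x) groupoid \<Rightarrow> bool" where
  "purely_infinite \<G> \<longleftrightarrow> etale_groupoid \<G> \<and> totally_disconnected (unit_space \<G>) \<and>
     (\<forall>A. compact_open (unit_space \<G>) A \<longrightarrow>
       (\<exists>U V. compact_open (arrows \<G>) U \<and> bisection \<G> U \<and>
              compact_open (arrows \<G>) V \<and> bisection \<G> V \<and>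
              source \<G> ` U = A \<and> source \<G> ` V = A \<and>
              range_map \<G> ` U \<union> range_map \<G> ` V \<subseteq> A \<and>
              range_map \<G> ` U \<inter> range_map \<G> ` V = {}))"

definition transformation_groupoid ::
    "('g, 'm) monoid_scheme \<Rightarrow> 'g set \<Rightarrow> ('g \<times> ('g set \<Rightarrow> nat), 'g set \<Rightarrow> nat) groupoid" where
  "transformation_groupoid G P = \<lparr>
     arrows = subtopology (prod_topology (discrete_topology (carrier G)) (spectrum_topology G P))
       {(g, \<phi>). \<phi> \<in> action_domain G P g},
     unit_space = spectrum_topology G P,
     source = (\<lambda>(g, \<phi>). \<phi>),
     range_map = (\<lambda>(g, \<phi>). action G P g \<phi>),
     compose_arrows = (\<lambda>(g, \<psi>) (h, \<phi>). (g \<otimes>\<^bsub>G\<^esub> h, \<phi>)),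
     inverse_arrow = (\<lambda>(g, \<phi>). (inv\<^bsub>G\<^esub> g, action G P g \<phi>)),
     unit_arrow = (\<lambda>\<phi>. (\<one>\<^bsub>G\<^esub>, \<phi>))\<rparr>"


section \<open>Well-definedness\<close>

locale subsemigroup_of_group = group G for G :: "('g, 'm) monoid_scheme" (structure) +
  fixes P :: "'g set"
  assumes subset: "P \<subseteq> carrier G"
    and nonempty: "P \<noteq> {}"
    and mult_closed: "p \<in> P \<Longrightarrow> q \<in> P \<Longrightarrow> p \<otimes> q \<in> P"
begin

abbreviation "S \<equiv> left_inverse_hull G P"
abbreviation "J \<equiv> constructible_ideals G P"

lemma P_carrier: "p \<in> P \<Longrightarrow> p \<in> carrier G"
  using subset by blast

lemma J_subset: "X \<in> J \<Longrightarrow> X \<subseteq> P"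
  by (induction rule: constructible_ideals.induct) (auto simp: left_preimage_def)

lemma translate_in_J:
  assumes "X \<in> J" "p \<in> P"
  shows "left_translate G p X \<in> J"
proof -
  obtain q where q: "q \<in> P" using nonempty by blast
  have "left_translate G p X = left_preimage G P q (left_translate G (q \<otimes> p) X)" (is "?L = ?R")
  proof
    show "?L \<subseteq> ?R"
    proof
      fix y assume "y \<in> ?L"
      then obtain x where x: "x \<in> X" "y = p \<otimes> x" by (auto simp: left_translate_def)
      then have "x \<in> P" using J_subset[OF assms(1)] by blast
      then have "y \<in> P" "q \<otimes> y = q \<otimes> p \<otimes> x"
        using x assms(2) q mult_closed P_carrier by (auto simp: m_assoc)
      then show "y \<in> ?R" using x(1) by (auto simp: left_translate_def left_preimage_def)
    qed
    show "?R \<subseteq> ?L"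
    proof
      fix y assume "y \<in> ?R"
      then obtain x where x: "y \<in> P" "x \<in> X" "q \<otimes> y = q \<otimes> p \<otimes> x"
        by (auto simp: left_translate_def left_preimage_def)
      have "x \<in> P" using x(2) J_subset[OF assms(1)] by blast
      then have "y = p \<otimes> x"
        using x(3) P_carrier assms(2) q x(1) by (simp add: m_assoc)
      then show "y \<in> ?L" using x(2) by (auto simp: left_translate_def)
    qed
  qed
  then show ?thesis
    using constructible_ideals.step[OF assms(1) q mult_closed[OF q assms(2)]] by simp
qed

lemma preimage_in_J:
  assumes "X \<in> J" "p \<in> P"
  shows "left_preimage G P p X \<in> J"
proof -
  obtain q where q: "q \<in> P" using nonempty by blast
  have "left_preimage G P p X = left_preimage G P (q \<otimes> p) (left_translate G q X)" (is "?L = ?R")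
  proof
    show "?L \<subseteq> ?R"
      using assms q P_carrier
      by (auto simp: left_translate_def left_preimage_def m_assoc)
    show "?R \<subseteq> ?L"
    proof
      fix y assume "y \<in> ?R"
      then obtain x where x: "y \<in> P" "x \<in> X" "q \<otimes> p \<otimes> y = q \<otimes> x"
        by (auto simp: left_translate_def left_preimage_def)
      have "x \<in> P" using x(2) J_subset[OF assms(1)] by blast
      then have "p \<otimes> y = x"
        using x(3) P_carrier assms(2) q x(1) by (simp add: m_assoc)
      then show "y \<in> ?L" using x(1,2) by (auto simp: left_preimage_def)
    qed
  qed
  then show ?thesis
    using constructible_ideals.step[OF assms(1) mult_closed[OF q assms(2)] q] by simp
qed

lemma hull_image: "s \<in> S \<Longrightarrow> (\<forall>X \<in> J. s `` X \<in> J \<and> s\<inverse> `` X \<in> J)"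
proof (induction rule: left_inverse_hull.induct)
  case zero
  then show ?case by (simp add: constructible_ideals.empty)
next
  case (transl p)
  have *: "{(x, p \<otimes> x) | x. x \<in> P} `` X = left_translate G p X"
          "{(x, p \<otimes> x) | x. x \<in> P}\<inverse> `` X = left_preimage G P p X" if "X \<in> J" for X
    using J_subset[OF that] by (auto simp: left_translate_def left_preimage_def)
  then show ?case using transl translate_in_J preimage_in_J by auto
next
  case (inverse s)
  then show ?case by simp
next
  case (comp s t)
  then show ?case by (simp add: relcomp_Image converse_relcomp)
qed

lemma hull_translation:
  "s \<in> S \<Longrightarrow> s \<subseteq> P \<times> P \<and> (\<exists>g \<in> carrier G. \<forall>(x, y) \<in> s. y = g \<otimes> x)"
proof (induction rule: left_inverse_hull.induct)
  case zero
  then show ?case by auto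
next
  case (transl p)
  then show ?case using mult_closed P_carrier by auto
next
  case (inverse s)
  then obtain g where g: "g \<in> carrier G" "\<forall>(x, y) \<in> s. y = g \<otimes> x" and sub: "s \<subseteq> P \<times> P" by auto
  have "x = inv g \<otimes> y" if "(x, y) \<in> s" for x y
  proof -
    have "x \<in> carrier G" "y = g \<otimes> x" using that sub g(2) P_carrier by auto
    then show ?thesis using g(1) by (simp add: m_assoc[symmetric])
  qed
  then show ?case using sub g(1) inv_closed by fastforce
next
  case (comp s t)
  then obtain g h where gh: "g \<in> carrier G" "\<forall>(x, y) \<in> s. y = g \<otimes> x"
    "h \<in> carrier G" "\<forall>(x, y) \<in> t. y = h \<otimes> x" and sub: "s \<subseteq> P \<times> P" "t \<subseteq> P \<times> P" by auto
  have "z = (g \<otimes> h) \<otimes> x" if "(x, z) \<in> t O s" for x z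
  proof -
    obtain y where y: "(x, y) \<in> t" "(y, z) \<in> s" using \<open>(x, z) \<in> t O s\<close> by blast
    then have "x \<in> carrier G" using sub P_carrier by auto
    moreover have "y = h \<otimes> x" "z = g \<otimes> y" using y gh by auto
    ultimately show ?thesis using gh by (simp add: m_assoc)
  qed
  then have "\<exists>g\<in>carrier G. \<forall>(x, y)\<in>t O s. y = g \<otimes> x"
    using gh(1,3) by (intro bexI[of _ "g \<otimes> h"]) auto
  moreover have "t O s \<subseteq> P \<times> P" using sub by blast
  ultimately show ?case by blast
qed

lemma Domain_in_J: "s \<in> S \<Longrightarrow> Domain s \<in> J"
proof -
  assume s: "s \<in> S"
  have "Domain s = s\<inverse> `` P" using hull_translation[OF s] by blast
  then show ?thesis using hull_image[OF s] constructible_ideals.whole[of P G] by simp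
qed

lemma grading_unique:
  assumes "s \<in> S" "s \<noteq> {}"
  shows "\<exists>!g. g \<in> carrier G \<and> (\<forall>(x, y) \<in> s. y = g \<otimes> x)"
proof -
  obtain g where g: "g \<in> carrier G" "\<forall>(x, y) \<in> s. y = g \<otimes> x"
    using hull_translation[OF assms(1)] by blast
  obtain x y where xy: "(x, y) \<in> s" using assms(2) by auto
  have x: "x \<in> carrier G" using xy hull_translation[OF assms(1)] P_carrier by blast
  show ?thesis
  proof (rule ex1I[of _ g])
    fix h assume "h \<in> carrier G \<and> (\<forall>(x, y) \<in> s. y = h \<otimes> x)"
    then have "h \<in> carrier G" "h \<otimes> x = g \<otimes> x" using xy g(2) by auto
    then show "h = g" using x g(1) by simp
  qed (use g in auto)
qed

lemma grading:
  assumes "s \<in> S" "s \<noteq> {}"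
  shows "grading G s \<in> carrier G" "(x, y) \<in> s \<Longrightarrow> y = grading G s \<otimes> x"
  using theI'[OF grading_unique[OF assms]] unfolding grading_def[symmetric] by auto

lemma Id_on_in_hull: "X \<in> J \<Longrightarrow> Id_on X \<in> S"
proof (induction rule: constructible_ideals.induct)
  case empty
  then show ?case by (simp add: left_inverse_hull.zero)
next
  case whole
  obtain p where p: "p \<in> P" using nonempty by blast
  let ?t = "{(x, p \<otimes> x) | x. x \<in> P}"
  have "?t O ?t\<inverse> = Id_on P" using p P_carrier by auto
  moreover have "?t O ?t\<inverse> \<in> S"
    by (intro left_inverse_hull.intros p)
  ultimately show ?case by simp
next
  case (step X p q)
  let ?p = "{(x, p \<otimes> x) | x. x \<in> P}" and ?q = "{(x, q \<otimes> x) | x. x \<in> P}"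
  let ?s = "((?p O ?q\<inverse>) O Id_on X) O (?q O ?p\<inverse>)"
  have "?s = Id_on (left_preimage G P p (left_translate G q X))"
    using step J_subset[OF step(1)] P_carrier
    by (auto simp: left_preimage_def left_translate_def Id_on_def relcomp_unfold)
  moreover have "?s \<in> S"
    by (intro left_inverse_hull.comp left_inverse_hull.inverse left_inverse_hull.transl step)
  ultimately show ?case by simp
qed

lemma hull_idempotents_eq: "hull_idempotents G P = Id_on ` J"
proof
  show "Id_on ` J \<subseteq> hull_idempotents G P"
    using Id_on_in_hull by (auto simp: hull_idempotents_def)
  show "hull_idempotents G P \<subseteq> Id_on ` J"
  proof
    fix e assume "e \<in> hull_idempotents G P"
    then have e: "e \<in> S" "e O e = e" by (auto simp: hull_idempotents_def)
    obtain g where g: "g \<in> carrier G" "\<forall>(x, y) \<in> e. y = g \<otimes> x"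
      using hull_translation[OF e(1)] by blast
    have "x = y" if "(x, y) \<in> e" for x y
    proof -
      obtain z where z: "(x, z) \<in> e" "(z, y) \<in> e" using \<open>(x, y) \<in> e\<close> e(2) by blast
      then have c: "x \<in> carrier G" "z \<in> carrier G"
        using hull_translation[OF e(1)] P_carrier by auto
      have "z = g \<otimes> x" "y = g \<otimes> z" "y = g \<otimes> x" using that z g(2) by auto
      then show ?thesis using c g(1) by simp
    qed
    then have "e = Id_on (Domain e)" by (fastforce simp: Id_on_iff)
    then show "e \<in> Id_on ` J" using Domain_in_J[OF e(1)] by blast
  qed
qed

lemma inter_in_J: "X \<in> J \<Longrightarrow> Y \<in> J \<Longrightarrow> X \<inter> Y \<in> J"
proof -
  assume "X \<in> J" "Y \<in> J"
  then have "Id_on X O Id_on Y \<in> S" by (intro left_inverse_hull.comp Id_on_in_hull)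
  then have "Domain (Id_on X O Id_on Y) \<in> J" by (rule Domain_in_J)
  moreover have "Domain (Id_on X O Id_on Y) = X \<inter> Y" by auto
  ultimately show ?thesis by simp
qed

lemma action_eq:
  assumes "\<phi> \<in> characters G P" "implements G P s g \<phi>" "X \<in> J"
  shows "action G P g \<phi> X = \<phi> (s\<inverse> `` (X \<inter> Range s))"
proof -
  define t where "t = (SOME s. implements G P s g \<phi>)"
  have t: "implements G P t g \<phi>" unfolding t_def using assms(2) by (rule someI)
  have st: "s \<in> S" "s \<noteq> {}" "grading G s = g" "\<phi> (Domain s) = 1"
           "t \<in> S" "t \<noteq> {}" "grading G t = g" "\<phi> (Domain t) = 1"
    using assms(2) t by (auto simp: implements_def)
  have mult: "\<phi> (A \<inter> B) = \<phi> A * \<phi> B" if "A \<in> J" "B \<in> J" for A B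
    using assms(1) that by (auto simp: characters_def)
  have im: "r\<inverse> `` (X \<inter> Range r) = r\<inverse> `` X" for r :: "('g \<times> 'g) set" by blast
  have J: "s\<inverse> `` X \<in> J" "t\<inverse> `` X \<in> J" "Domain s \<in> J" "Domain t \<in> J"
    using hull_image st assms(3) Domain_in_J by blast+
  have val: "(x, y) \<in> s \<Longrightarrow> y = g \<otimes> x" "(x, y) \<in> t \<Longrightarrow> y = g \<otimes> x" for x y
    using grading(2)[OF st(1,2)] grading(2)[OF st(5,6)] st(3,7) by auto
  have "s\<inverse> `` X \<inter> Domain t = t\<inverse> `` X \<inter> Domain s"
    using val by (auto simp: Image_iff) (metis)+
  then have "\<phi> (s\<inverse> `` X) = \<phi> (t\<inverse> `` X)"
    using mult[OF J(1,4)] mult[OF J(2,3)] st(4,8) by simp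
  then show ?thesis
    using assms(3) by (simp add: action_def t_def[symmetric] im Let_def)
qed

end

lemma cring_ring_of_class: "cring (ring_of_class :: 'a::comm_ring_1 ring)"
proof (intro cringI abelian_groupI comm_monoidI)
  fix x :: 'a assume "x \<in> carrier ring_of_class"
  show "\<exists>y \<in> carrier ring_of_class. y \<oplus>\<^bsub>ring_of_class\<^esub> x = \<zero>\<^bsub>ring_of_class\<^esub>"
    by (intro bexI[of _ "- x"]) (auto simp: ring_of_class_def)
qed (auto simp: ring_of_class_def algebra_simps)

lemma axb_group: "group (axb_group :: ('k::field \<times> 'k) monoid)"
proof (rule groupI)
  fix x :: "'k \<times> 'k" assume x: "x \<in> carrier axb_group"
  obtain b a where [simp]: "x = (b, a)" by force
  show "\<exists>y \<in> carrier axb_group. y \<otimes>\<^bsub>axb_group\<^esub> x = \<one>\<^bsub>axb_group\<^esub>"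
    using x by (intro bexI[of _ "(- b / a, 1 / a)"]) (auto simp: axb_group_def field_simps)
qed (auto simp: axb_group_def algebra_simps)

lemma axb_subsemigroup: "subsemigroup_of_group axb_group (axb_semigroup :: ('a::idom fract \<times> 'a fract) set)"
proof -
  interpret group "axb_group :: ('a fract \<times> 'a fract) monoid" by (rule axb_group)
  show ?thesis
  proof
    show "axb_semigroup \<subseteq> carrier (axb_group :: ('a fract \<times> 'a fract) monoid)"
      by (auto simp: axb_semigroup_def axb_group_def Fraction_Field.Zero_fract_def Fraction_Field.eq_fract)
    show "(axb_semigroup :: ('a fract \<times> 'a fract) set) \<noteq> {}"
      by (auto simp: axb_semigroup_def intro: exI[of _ 1])
    fix p q :: "'a fract \<times> 'a fract"
    assume "p \<in> axb_semigroup" "q \<in> axb_semigroup"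
    then obtain b a d c where "p = (Fraction_Field.Fract b 1, Fraction_Field.Fract a 1)" "q = (Fraction_Field.Fract d 1, Fraction_Field.Fract c 1)" "a \<noteq> 0" "c \<noteq> 0"
      by (auto simp: axb_semigroup_def)
    then show "p \<otimes>\<^bsub>axb_group\<^esub> q \<in> axb_semigroup"
      unfolding axb_semigroup_def axb_group_def
      by (intro CollectI exI[of _ "b + a * d"] exI[of _ "a * c"]) simp
  qed
qed

end

theory Submission
  imports Defs
begin

text \<open>A compact open set \<open>A\<close> of characters is described by finitely many constructible ideals, and the
  nonempty ones among them have the form \<open>(b + I) \<times> I\<^sup>\<times>\<close> for ideals \<open>I \<noteq> 0\<close> of \<open>R\<close>. Choose \<open>a \<noteq> 0\<close> in all
  these \<open>I\<close>. Since \<open>Jac(R) = 0\<close> and \<open>R\<close> is not a field, some \<open>c \<in> 1 + aR\<close> is neither zero nor a unit.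
  Taking preimages under \<open>(0, c)\<close> and \<open>(c - 1, c)\<close> fixes each of the finitely many ideals, so both
  elements act on characters by maps of \<open>A\<close> into itself; the images are disjoint because \<open>c\<close> is not
  a unit, so that \<open>c - 1 \<notin> cR\<close>.\<close>

section \<open>The partial action on the spectrum\<close>

context subsemigroup_of_group
begin

abbreviation "\<Omega> \<equiv> characters G P"
abbreviation "D \<equiv> action_domain G P"
abbreviation "act \<equiv> action G P"

section \<open>Elementary properties of characters\<close>

lemma character_mult: "\<phi> \<in> \<Omega> \<Longrightarrow> X \<in> J \<Longrightarrow> Y \<in> J \<Longrightarrow> \<phi> (X \<inter> Y) = \<phi> X * \<phi> Y"
  by (auto simp: characters_def)

lemma character_empty: "\<phi> \<in> \<Omega> \<Longrightarrow> \<phi> {} = 0"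
  by (auto simp: characters_def)

lemma character_PiE: "\<phi> \<in> \<Omega> \<Longrightarrow> \<phi> \<in> J \<rightarrow>\<^sub>E {0, 1}"
  by (auto simp: characters_def)

lemma character_values: "\<phi> \<in> \<Omega> \<Longrightarrow> X \<in> J \<Longrightarrow> \<phi> X = 0 \<or> \<phi> X = 1"
  by (drule character_PiE) (auto dest: PiE_mem)

text \<open>Every constructible ideal lies in \<open>P\<close>, so a nonzero value at
  \<open>X\<close> can be cancelled from \<open>\<phi> X = \<phi> X * \<phi> P\<close>.\<close>

lemma character_P:
  assumes "\<phi> \<in> \<Omega>"
  shows "\<phi> P = 1"
proof -
  obtain X where X: "X \<in> J" "\<phi> X \<noteq> 0"
    using assms by (auto simp: characters_def)
  have "X \<inter> P = X" using J_subset[OF X(1)] by blast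
  then show ?thesis
    using character_mult[OF assms X(1) constructible_ideals.whole] X(2) by simp
qed

text \<open>The existence of a nonzero value is traded for the single equation
  \<open>\<phi> P = 1\<close>. All conditions are then equations between coordinates, which makes
  the characters a closed subset of the product.\<close>

lemma characters_iff:
  "\<phi> \<in> \<Omega> \<longleftrightarrow> \<phi> \<in> J \<rightarrow>\<^sub>E {0, 1} \<and> \<phi> P = 1 \<and> \<phi> {} = 0 \<and>
     (\<forall>X \<in> J. \<forall>Y \<in> J. \<phi> (X \<inter> Y) = \<phi> X * \<phi> Y)" (is "_ \<longleftrightarrow> ?R")
proof
  show "\<phi> \<in> \<Omega> \<Longrightarrow> ?R"
    using character_P by (auto simp: characters_def)
  show "?R \<Longrightarrow> \<phi> \<in> \<Omega>"
    using constructible_ideals.whole[of P G] by (force simp: characters_def)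
qed

text \<open>The value 1 at \<open>Domain s\<close> forces \<open>s\<close> to be nonempty, because
  characters vanish at \<open>{}\<close>. For nonempty \<open>s\<close> the translating element is
  unique, so the description in \<open>grading\<close> becomes a pointwise condition.\<close>

lemma implements_iff:
  assumes "\<phi> \<in> \<Omega>"
  shows "implements G P s g \<phi> \<longleftrightarrow>
    s \<in> S \<and> g \<in> carrier G \<and> (\<forall>(x, y) \<in> s. y = g \<otimes> x) \<and> \<phi> (Domain s) = 1"
proof (cases "s \<in> S \<and> s \<noteq> {}")
  case True
  then have "grading G s = g \<longleftrightarrow> g \<in> carrier G \<and> (\<forall>(x, y) \<in> s. y = g \<otimes> x)"
    using theI'[OF grading_unique] the1_equality[OF grading_unique]
    by (auto simp del: split_paired_All simp: grading_def)
  then show ?thesis using True by (auto simp: implements_def)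
next
  case False
  then show ?thesis using character_empty[OF assms] by (auto simp: implements_def)
qed

lemma action_domain_iff:
  "\<phi> \<in> D g \<longleftrightarrow> \<phi> \<in> \<Omega> \<and> (\<exists>s. implements G P s g \<phi>)"
  by (simp add: action_domain_def)

lemma action_domain_carrier: "\<phi> \<in> D g \<Longrightarrow> g \<in> carrier G"
  by (auto simp: action_domain_iff implements_iff)

lemma action_domain_character: "\<phi> \<in> D g \<Longrightarrow> \<phi> \<in> \<Omega>"
  by (simp add: action_domain_iff)

lemma action_apply:
  assumes "\<phi> \<in> \<Omega>" "implements G P s g \<phi>" "X \<in> J"
  shows "act g \<phi> X = \<phi> (s\<inverse> `` X)"
proof -
  have "s\<inverse> `` (X \<inter> Range s) = s\<inverse> `` X" by blast
  then show ?thesis using action_eq[OF assms] by simp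
qed

lemma action_extensional: "act g \<phi> \<in> extensional J"
  by (simp add: action_def Let_def)

text \<open>Preimages under \<open>s\<close> commute with intersections because \<open>s\<close> is
  single-valued, and the preimage of \<open>P\<close> is \<open>Domain s\<close>, where \<phi> is
  1.\<close>

lemma action_character:
  assumes "\<phi> \<in> D g"
  shows "act g \<phi> \<in> \<Omega>"
proof -
  have \<phi>: "\<phi> \<in> \<Omega>" using assms by (rule action_domain_character)
  obtain s where s: "implements G P s g \<phi>" using assms by (auto simp: action_domain_iff)
  then have sS: "s \<in> S" and g: "\<forall>(x, y) \<in> s. y = g \<otimes> x" "g \<in> carrier G" and dom: "\<phi> (Domain s) = 1"
    using implements_iff[OF \<phi>] by auto
  have J: "s\<inverse> `` X \<in> J" if "X \<in> J" for X using hull_image[OF sS] that by blast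
  note val = action_apply[OF \<phi> s]
  have "s \<subseteq> P \<times> P" using hull_translation[OF sS] by blast
  then have "s\<inverse> `` P = Domain s" by blast
  moreover have "s\<inverse> `` (X \<inter> Y) = s\<inverse> `` X \<inter> s\<inverse> `` Y" for X Y using g(1) by auto
  ultimately show ?thesis
    using J dom character_values[OF \<phi>] action_extensional
    by (auto simp: characters_iff val constructible_ideals.whole constructible_ideals.empty
        inter_in_J character_empty[OF \<phi>] character_mult[OF \<phi>] PiE_def)
qed

section \<open>Inverses, composition and units of the partial action\<close>

lemma implements_inverse:
  assumes "\<phi> \<in> \<Omega>" "implements G P s g \<phi>"
  shows "implements G P (s\<inverse>) (inv g) (act g \<phi>)"
proof -
  have s: "s \<in> S" "g \<in> carrier G" "\<phi> (Domain s) = 1" and g: "\<forall>(x, y) \<in> s. y = g \<otimes> x"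
    using assms(2) implements_iff[OF assms(1)] by auto
  have sub: "s \<subseteq> P \<times> P" using hull_translation[OF s(1)] by blast
  have "act g \<phi> \<in> \<Omega>"
    using assms by (intro action_character) (auto simp: action_domain_iff)
  moreover have "x = inv g \<otimes> y" if "(x, y) \<in> s" for x y
  proof -
    have "x \<in> P" "y = g \<otimes> x" using g sub \<open>(x, y) \<in> s\<close> by blast+
    then show ?thesis using P_carrier s(2) by (simp add: m_assoc[symmetric])
  qed
  then have "\<forall>(y, x) \<in> s\<inverse>. x = inv g \<otimes> y" by blast
  \<comment> \<open>The domain of the converse is \<open>Range s\<close>, whose preimage under
    \<open>s\<close> is all of \<open>Domain s\<close>.\<close>
  moreover have "act g \<phi> (Domain (s\<inverse>)) = 1"
  proof -
    have "s\<inverse> `` Range s = Domain s" by blast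
    then show ?thesis
      using action_apply[OF assms, of "Range s"] Domain_in_J[of "s\<inverse>"] s
      by (simp add: left_inverse_hull.inverse)
  qed
  ultimately show ?thesis
    using s by (simp add: implements_iff left_inverse_hull.inverse)
qed

text \<open>The composite is defined on the preimage of \<open>Domain s\<close> under
  \<open>t\<close>, and \<phi> takes there the value of \<open>act h \<phi>\<close> at
  \<open>Domain s\<close>.\<close>

lemma implements_comp:
  assumes "\<phi> \<in> \<Omega>" "implements G P t h \<phi>" "implements G P s g (act h \<phi>)"
  shows "implements G P (t O s) (g \<otimes> h) \<phi>"
proof -
  have h: "act h \<phi> \<in> \<Omega>"
    using assms by (intro action_character) (auto simp: action_domain_iff)
  have t: "t \<in> S" "h \<in> carrier G" "\<forall>(x, y) \<in> t. y = h \<otimes> x"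
    using assms(2) implements_iff[OF assms(1)] by auto
  have s: "s \<in> S" "g \<in> carrier G" "\<forall>(x, y) \<in> s. y = g \<otimes> x" "act h \<phi> (Domain s) = 1"
    using assms(3) implements_iff[OF h] by auto
  have "Domain (t O s) = t\<inverse> `` Domain s" by blast
  then have "\<phi> (Domain (t O s)) = 1"
    using action_apply[OF assms(1,2) Domain_in_J[OF s(1)]] s(4) by simp
  moreover have "\<forall>(x, z) \<in> t O s. z = (g \<otimes> h) \<otimes> x"
  proof (clarify)
    fix x y z assume xyz: "(x, y) \<in> t" "(y, z) \<in> s"
    then have "y = h \<otimes> x" "z = g \<otimes> y" "x \<in> carrier G"
      using s(3) t(3) hull_translation[OF t(1)] P_carrier by auto
    then show "z = (g \<otimes> h) \<otimes> x" using s(2) t(2) by (simp add: m_assoc)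
  qed
  ultimately show ?thesis
    using s t by (simp add: implements_iff[OF assms(1)] left_inverse_hull.comp)
qed

lemma implements_one: "\<phi> \<in> \<Omega> \<Longrightarrow> implements G P (Id_on P) \<one> \<phi>"
  using P_carrier
  by (auto simp: implements_iff Id_on_in_hull constructible_ideals.whole character_P)

text \<open>The domain of this graph is \<open>P\<close>, where every character is 1. Hence elements
  of \<open>P\<close> act on the whole spectrum.\<close>

lemma implements_translation:
  assumes "\<phi> \<in> \<Omega>" "p \<in> P"
  shows "implements G P {(x, p \<otimes> x) | x. x \<in> P} p \<phi>"
proof -
  have "Domain {(x, p \<otimes> x) | x. x \<in> P} = P" by blast
  then show ?thesis
    using assms by (auto simp: implements_iff left_inverse_hull.transl P_carrier character_P)
qed

lemma action_eqI:
  assumes "\<phi> \<in> \<Omega>" "\<And>X. X \<in> J \<Longrightarrow> act g \<phi>' X = \<phi> X"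
  shows "act g \<phi>' = \<phi>"
  using assms character_PiE action_extensional
  by (intro extensionalityI[of _ J]) (auto simp: PiE_def)

lemma action_one: "\<phi> \<in> \<Omega> \<Longrightarrow> act \<one> \<phi> = \<phi>"
proof (rule action_eqI)
  fix X assume "\<phi> \<in> \<Omega>" "X \<in> J"
  moreover have "(Id_on P)\<inverse> `` X = X" using J_subset[OF \<open>X \<in> J\<close>] by auto
  ultimately show "act \<one> \<phi> X = \<phi> X"
    using action_apply[OF _ implements_one, of \<phi> X] by simp
qed

lemma action_domain_one: "D \<one> = \<Omega>"
  using implements_one unfolding action_domain_iff set_eq_iff by blast

lemma action_domain_comp:
  "\<phi> \<in> D h \<Longrightarrow> act h \<phi> \<in> D g \<Longrightarrow> \<phi> \<in> D (g \<otimes> h)"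
  using implements_comp unfolding action_domain_iff by blast

text \<open>Pulling back along \<open>t O s\<close> means pulling back along \<open>s\<close> and
  then along \<open>t\<close>, so evaluating with the composite relation gives both sides.\<close>

lemma action_comp:
  assumes "\<phi> \<in> D h" "act h \<phi> \<in> D g"
  shows "act (g \<otimes> h) \<phi> = act g (act h \<phi>)"
proof (rule action_eqI)
  show h: "act g (act h \<phi>) \<in> \<Omega>" by (rule action_character) fact
  fix X assume X: "X \<in> J"
  obtain s t where st: "implements G P t h \<phi>" "implements G P s g (act h \<phi>)"
    and \<phi>: "\<phi> \<in> \<Omega>" "act h \<phi> \<in> \<Omega>"
    using assms by (auto simp: action_domain_iff)
  have "s\<inverse> `` X \<in> J"
    using st(2) hull_image X by (auto simp: implements_def)
  moreover have "(t O s)\<inverse> `` X = t\<inverse> `` (s\<inverse> `` X)" by blast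
  ultimately show "act (g \<otimes> h) \<phi> X = act g (act h \<phi>) X"
    using st \<phi> X by (simp add: action_apply[OF \<phi>(1) implements_comp] action_apply)
qed

lemma action_domain_inverse: "\<phi> \<in> D g \<Longrightarrow> act g \<phi> \<in> D (inv g)"
  using implements_inverse action_character by (auto simp: action_domain_iff)

lemma action_inverse: "\<phi> \<in> D g \<Longrightarrow> act (inv g) (act g \<phi>) = \<phi>"
  using action_comp[of \<phi> g "inv g"] action_domain_inverse action_domain_carrier
  by (simp add: action_one action_domain_character)

lemma action_inverse':
  assumes "\<phi> \<in> D (inv g)" "g \<in> carrier G"
  shows "act (inv g) \<phi> \<in> D g" "act g (act (inv g) \<phi>) = \<phi>"
  using action_domain_inverse[OF assms(1)] action_inverse[OF assms(1)] assms(2) by simp_all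

lemma action_translation:
  assumes "\<phi> \<in> \<Omega>" "p \<in> P"
  shows "\<phi> \<in> D p" and "X \<in> J \<Longrightarrow> act p \<phi> X = \<phi> (left_preimage G P p X)"
proof -
  show "\<phi> \<in> D p" using assms implements_translation by (auto simp: action_domain_iff)
  have "{(x, p \<otimes> x) | x. x \<in> P}\<inverse> `` X = left_preimage G P p X"
    by (auto simp: left_preimage_def)
  then show "act p \<phi> X = \<phi> (left_preimage G P p X)" if "X \<in> J"
    using action_apply[OF assms(1) implements_translation[OF assms] that] by simp
qed

section \<open>The topology of the spectrum\<close>

abbreviation "T \<equiv> spectrum_topology G P"

section \<open>Evaluation maps and continuity into the spectrum\<close>

lemma topspace_spectrum [simp]: "topspace T = \<Omega>"
  unfolding spectrum_topology_def topspace_subtopology topspace_product_topology o_def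
    topspace_discrete_topology using character_PiE by blast

lemma continuous_map_evaluation:
  assumes "X \<in> J"
  shows "continuous_map T (discrete_topology {0, 1}) (\<lambda>\<phi>. \<phi> X)"
  unfolding spectrum_topology_def
  using assms by (intro continuous_map_from_subtopology continuous_map_product_projection)

lemma openin_evaluation:
  assumes "X \<in> J"
  shows "openin T {\<phi> \<in> \<Omega>. \<phi> X = v}"
proof -
  have "openin T {\<phi> \<in> topspace T. \<phi> X \<in> {v} \<inter> {0, 1}}"
    by (rule openin_continuous_map_preimage[OF continuous_map_evaluation[OF assms]]) simp
  moreover have "{\<phi> \<in> topspace T. \<phi> X \<in> {v} \<inter> {0, 1}} = {\<phi> \<in> \<Omega>. \<phi> X = v}"
    using character_values assms by fastforce
  ultimately show ?thesis by simp
qed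

lemma closedin_evaluation:
  assumes "X \<in> J"
  shows "closedin T {\<phi> \<in> \<Omega>. \<phi> X = v}"
proof -
  have "closedin T {\<phi> \<in> topspace T. \<phi> X \<in> {v} \<inter> {0, 1}}"
    by (rule closedin_continuous_map_preimage[OF continuous_map_evaluation[OF assms]]) simp
  moreover have "{\<phi> \<in> topspace T. \<phi> X \<in> {v} \<inter> {0, 1}} = {\<phi> \<in> \<Omega>. \<phi> X = v}"
    using character_values assms by fastforce
  ultimately show ?thesis by simp
qed

text \<open>Continuity into the product is tested coordinatewise. Each coordinate is discrete, so
  open fibres suffice.\<close>

lemma continuous_map_into_spectrum:
  assumes "\<And>z. z \<in> topspace Z \<Longrightarrow> f z \<in> \<Omega>"
    and "\<And>X v. X \<in> J \<Longrightarrow> openin Z {z \<in> topspace Z. f z X = v}"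
  shows "continuous_map Z T f"
  unfolding spectrum_topology_def
proof (intro continuous_map_into_subtopology continuous_map_componentwise[THEN iffD2] conjI ballI)
  show "f \<in> topspace Z \<rightarrow> \<Omega>" using assms(1) by blast
  show "f ` topspace Z \<subseteq> extensional J" using assms(1) character_PiE by (auto simp: PiE_def)
  fix X assume X: "X \<in> J"
  show "continuous_map Z (discrete_topology {0, 1}) (\<lambda>z. f z X)"
    unfolding continuous_map_def
  proof (intro conjI allI impI)
    show "(\<lambda>z. f z X) \<in> topspace Z \<rightarrow> topspace (discrete_topology {0, 1})"
      using assms(1) character_values[OF _ X] by auto
    fix U :: "nat set"
    have "{z \<in> topspace Z. f z X \<in> U} = (\<Union>v \<in> U. {z \<in> topspace Z. f z X = v})" by blast
    then show "openin Z {z \<in> topspace Z. f z X \<in> U}" using assms(2)[OF X] by auto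
  qed
qed

section \<open>The spectrum as a compact, totally disconnected Hausdorff space\<close>

lemma Hausdorff_spectrum: "Hausdorff_space T"
  by (simp add: spectrum_topology_def Hausdorff_space_subtopology Hausdorff_space_product_topology)

text \<open>The product of two-point spaces is compact, and each equation in
  \<open>characters_iff\<close> compares continuous functions with values in a discrete space, so it
  defines a closed set.\<close>

lemma compact_spectrum: "compact_space T"
proof -
  define Z where "Z = product_topology (\<lambda>X :: 'g set. discrete_topology {0 :: nat, 1}) J"
  have topZ: "topspace Z = J \<rightarrow>\<^sub>E {0, 1}" by (simp add: Z_def)
  have "compact_space Z"
    unfolding Z_def compact_space_product_topology by (simp add: compact_space_discrete_topology)
  have ev: "continuous_map Z (discrete_topology {0, 1}) (\<lambda>\<phi>. \<phi> X)" if "X \<in> J" for X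
    unfolding Z_def using that by (rule continuous_map_product_projection)
  have cl: "closedin Z {\<phi> \<in> topspace Z. \<phi> X = v}" if "X \<in> J" "v \<in> {0, 1}" for X v
    using closedin_continuous_map_preimage[OF ev[OF that(1)], of "{v}"] that(2) by simp
  have "closedin Z {\<phi> \<in> topspace Z. \<phi> (X \<inter> Y) = \<phi> X * \<phi> Y}" if XY: "X \<in> J" "Y \<in> J" for X Y
  proof (rule closedin_continuous_maps_eq[of "discrete_topology {0, 1}"])
    show "continuous_map Z (discrete_topology {0, 1}) (\<lambda>\<phi>. \<phi> (X \<inter> Y))"
      by (rule ev) (simp add: inter_in_J XY)
    have "continuous_map Z (prod_topology (discrete_topology {0, 1}) (discrete_topology {0, 1}))
        (\<lambda>\<phi>. (\<phi> X, \<phi> Y))"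
      using ev XY by (simp add: continuous_map_pairedI)
    \<comment> \<open>Multiplication on \<open>{0, 1}\<close> is continuous because a product of two
      discrete spaces is discrete.\<close>
    then have "continuous_map Z (discrete_topology {0, 1}) ((\<lambda>(u, v). u * v) \<circ> (\<lambda>\<phi>. (\<phi> X, \<phi> Y)))"
      by (rule continuous_map_compose) (auto simp flip: prod_topology_discrete_topology)
    then show "continuous_map Z (discrete_topology {0, 1}) (\<lambda>\<phi>. \<phi> X * \<phi> Y)" by (simp add: o_def)
  qed simp
  then have "closedin Z ({\<phi> \<in> topspace Z. \<phi> P = 1} \<inter> {\<phi> \<in> topspace Z. \<phi> {} = 0} \<inter>
      (\<Inter>X \<in> J. \<Inter>Y \<in> J. {\<phi> \<in> topspace Z. \<phi> (X \<inter> Y) = \<phi> X * \<phi> Y}))"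
    using constructible_ideals.whole[of P G] constructible_ideals.empty[of G P]
    by (intro closedin_Int closedin_Inter cl) (auto simp del: INT_simps intro!: closedin_Inter)
  moreover have "({\<phi> \<in> topspace Z. \<phi> P = 1} \<inter> {\<phi> \<in> topspace Z. \<phi> {} = 0} \<inter>
      (\<Inter>X \<in> J. \<Inter>Y \<in> J. {\<phi> \<in> topspace Z. \<phi> (X \<inter> Y) = \<phi> X * \<phi> Y})) = \<Omega>"
    unfolding topZ set_eq_iff characters_iff Int_iff INT_iff mem_Collect_eq
    using constructible_ideals.whole[of P G] by blast
  ultimately have "closedin Z \<Omega>" by simp
  then have "compactin Z \<Omega>" using \<open>compact_space Z\<close> by (simp add: closedin_compact_space)
  then show ?thesis
    by (simp add: spectrum_topology_def compact_space_subtopology Z_def)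
qed

text \<open>Level sets of evaluations are clopen, so a connected set lies in a single level set of
  every evaluation, and the evaluations separate characters.\<close>

lemma totally_disconnected_spectrum: "totally_disconnected T"
  unfolding totally_disconnected_def
proof (intro allI impI)
  fix C assume C: "connectedin T C"
  then have sub: "C \<subseteq> \<Omega>" using connectedin_subset_topspace by fastforce
  have "\<phi> = \<psi>" if "\<phi> \<in> C" "\<psi> \<in> C" for \<phi> \<psi>
  proof (rule extensionalityI[of _ J])
    show "\<phi> \<in> extensional J" "\<psi> \<in> extensional J"
      using that sub character_PiE by (auto simp: PiE_def)
    fix X assume X: "X \<in> J"
    have "C \<subseteq> {\<theta> \<in> \<Omega>. \<theta> X = \<phi> X} \<or> disjnt C {\<theta> \<in> \<Omega>. \<theta> X = \<phi> X}"
      by (rule connectedin_clopen_cases[OF C closedin_evaluation[OF X] openin_evaluation[OF X]])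
    then show "\<phi> X = \<psi> X" using that sub by (auto simp: disjnt_iff)
  qed
  then show "\<exists>x. C \<subseteq> {x}" by blast
qed

text \<open>Each point of \<open>A\<close> has a cylinder neighbourhood inside \<open>A\<close>, and
  finitely many of these cover \<open>A\<close>. Let \<open>F\<close> collect the coordinates
  constrained by them: a character that agrees on \<open>F\<close> with a point of \<open>A\<close>
  lies in the same cylinder as that point.\<close>

lemma compact_open_finite_support:
  assumes "compact_open T A"
  obtains F where "finite F" "F \<subseteq> J"
    "\<And>\<phi> \<psi>. \<phi> \<in> A \<Longrightarrow> \<psi> \<in> \<Omega> \<Longrightarrow> (\<And>X. X \<in> F \<Longrightarrow> \<psi> X = \<phi> X) \<Longrightarrow> \<psi> \<in> A"
proof -
  have A: "compactin T A" "openin T A" using assms by (auto simp: compact_open_def)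
  then have sub: "A \<subseteq> \<Omega>" using openin_subset by fastforce
  define N where "N = (\<lambda>F \<phi>. {\<psi> \<in> \<Omega>. \<forall>X \<in> F. \<psi> X = \<phi> X})"
  have "\<exists>F. finite F \<and> F \<subseteq> J \<and> N F \<phi> \<subseteq> A" if \<phi>: "\<phi> \<in> A" for \<phi>
  proof -
    obtain W where W: "openin (product_topology (\<lambda>X. discrete_topology {0, 1}) J) W" "A = W \<inter> \<Omega>"
      using A(2) by (auto simp: spectrum_topology_def openin_subtopology)
    \<comment> \<open>A basic open box constrains only finitely many coordinates; these define the
      cylinder.\<close>
    then obtain U where U: "finite {X \<in> J. U X \<noteq> {0, 1}}" "\<phi> \<in> Pi\<^sub>E J U" "Pi\<^sub>E J U \<subseteq> W"
      using \<phi> by (auto simp: openin_product_topology_alt)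
    have "N {X \<in> J. U X \<noteq> {0, 1}} \<phi> \<subseteq> A"
    proof
      fix \<psi> assume "\<psi> \<in> N {X \<in> J. U X \<noteq> {0, 1}} \<phi>"
      then have \<psi>: "\<psi> \<in> \<Omega>" "\<And>X. X \<in> J \<Longrightarrow> U X \<noteq> {0, 1} \<Longrightarrow> \<psi> X = \<phi> X" by (auto simp: N_def)
      have "\<psi> X \<in> U X" if X: "X \<in> J" for X
      proof (cases "U X = {0, 1}")
        case True
        then show ?thesis using character_values[OF \<psi>(1) X] by auto
      next
        case False
        then show ?thesis using \<psi>(2)[OF X] PiE_mem[OF U(2) X] by simp
      qed
      then have "\<psi> \<in> Pi\<^sub>E J U" using character_PiE[OF \<psi>(1)] by (auto simp: PiE_def)
      then show "\<psi> \<in> A" using U(3) W(2) \<psi>(1) by blast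
    qed
    then show ?thesis using U(1) by blast
  qed
  then obtain F where F: "\<And>\<phi>. \<phi> \<in> A \<Longrightarrow> finite (F \<phi>)" "\<And>\<phi>. \<phi> \<in> A \<Longrightarrow> F \<phi> \<subseteq> J"
    "\<And>\<phi>. \<phi> \<in> A \<Longrightarrow> N (F \<phi>) \<phi> \<subseteq> A" by metis
  have "openin T (N (F \<phi>) \<phi>)" if "\<phi> \<in> A" for \<phi>
  proof -
    have "N (F \<phi>) \<phi> = (\<Inter>X \<in> F \<phi>. {\<psi> \<in> \<Omega>. \<psi> X = \<phi> X}) \<inter> topspace T"
      by (auto simp: N_def)
    moreover have "openin T ((\<Inter>X \<in> F \<phi>. {\<psi> \<in> \<Omega>. \<psi> X = \<phi> X}) \<inter> topspace T)"
      using F[OF that] by (intro openin_INT openin_evaluation) auto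
    ultimately show ?thesis by simp
  qed
  moreover have "A \<subseteq> \<Union> ((\<lambda>\<phi>. N (F \<phi>) \<phi>) ` A)" using sub by (auto simp: N_def)
  ultimately obtain \<C> where \<C>: "finite \<C>" "\<C> \<subseteq> (\<lambda>\<phi>. N (F \<phi>) \<phi>) ` A" "A \<subseteq> \<Union> \<C>"
    using compactinD[OF A(1), of "(\<lambda>\<phi>. N (F \<phi>) \<phi>) ` A"] by auto
  then obtain B where B: "finite B" "B \<subseteq> A" "A \<subseteq> (\<Union>\<phi> \<in> B. N (F \<phi>) \<phi>)"
    using finite_subset_image[OF \<C>(1,2)] by blast
  show thesis
  proof (rule that[of "\<Union> (F ` B)"])
    show "finite (\<Union> (F ` B))" "\<Union> (F ` B) \<subseteq> J" using B F by blast+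
    fix \<phi> \<psi> assume *: "\<phi> \<in> A" "\<psi> \<in> \<Omega>" "\<And>X. X \<in> \<Union> (F ` B) \<Longrightarrow> \<psi> X = \<phi> X"
    then obtain \<theta> where \<theta>: "\<theta> \<in> B" "\<phi> \<in> N (F \<theta>) \<theta>" using B(3) by blast
    then have "\<psi> X = \<phi> X" if "X \<in> F \<theta>" for X using *(3) that by blast
    then have "\<psi> \<in> N (F \<theta>) \<theta>" using *(2) \<theta>(2) by (simp add: N_def)
    then show "\<psi> \<in> A" using F(3) \<theta>(1) B(2) by blast
  qed
qed

section \<open>Openness of the domains and continuity of the partial action\<close>

lemma openin_action_domain_preimage:
  assumes "X \<in> J"
  shows "openin T {\<phi> \<in> D g. act g \<phi> X = v}"
proof -
  let ?V = "\<lambda>s. {\<phi> \<in> \<Omega>. \<phi> (Domain s) = 1} \<inter> {\<phi> \<in> \<Omega>. \<phi> (s\<inverse> `` X) = v}"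
  let ?I = "{s \<in> S. g \<in> carrier G \<and> (\<forall>(x, y) \<in> s. y = g \<otimes> x)}"
  \<comment> \<open>The union over \<open>s\<close> absorbs the choice of an implementing relation.
    An empty \<open>s\<close> contributes no character, since \<open>\<phi> {} = 0\<close>.\<close>
  have "{\<phi> \<in> D g. act g \<phi> X = v} = (\<Union>s \<in> ?I. ?V s)"
    using assms action_apply[OF _ _ assms] unfolding action_domain_iff set_eq_iff
    by (auto simp: implements_iff; blast)
  moreover have "openin T (?V s)" if "s \<in> S" for s
    using that Domain_in_J hull_image assms by (intro openin_Int openin_evaluation) auto
  ultimately show ?thesis by auto
qed

text \<open>Since \<open>act g \<phi>\<close> is a character, it is 1 at \<open>P\<close>;
  prescribing that value cuts out the whole domain.\<close>

lemma openin_action_domain: "openin T (D g)"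
proof -
  have "act g \<phi> P = 1" if "\<phi> \<in> D g" for \<phi>
    using character_P[OF action_character[OF that]] .
  then have "{\<phi> \<in> D g. act g \<phi> P = 1} = D g" by (simp cong: conj_cong)
  then show ?thesis
    using openin_action_domain_preimage[OF constructible_ideals.whole, of g 1] by (simp only:)
qed

lemma topspace_action_domain [simp]: "topspace (subtopology T (D g)) = D g"
  using action_domain_character by auto

lemma continuous_map_action: "continuous_map (subtopology T (D g)) T (act g)"
proof (rule continuous_map_into_spectrum)
  fix X v assume "X \<in> J"
  then show "openin (subtopology T (D g)) {\<phi> \<in> topspace (subtopology T (D g)). act g \<phi> X = v}"
    using openin_action_domain_preimage[of X g v] unfolding topspace_action_domain
    by (auto simp: openin_open_subtopology openin_action_domain)
qed (use action_character in auto)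

section \<open>The transformation groupoid\<close>

abbreviation "Gr \<equiv> transformation_groupoid G P"
abbreviation "Ar \<equiv> arrows (transformation_groupoid G P)"

section \<open>The topology of the arrow space\<close>

lemma groupoid_simps [simp]:
  "unit_space Gr = T"
  "source Gr = snd"
  "range_map Gr (g, \<phi>) = act g \<phi>"
  "compose_arrows Gr (g, \<psi>) (h, \<phi>) = (g \<otimes> h, \<phi>)"
  "inverse_arrow Gr (g, \<phi>) = (inv g, act g \<phi>)"
  "unit_arrow Gr \<phi> = (\<one>, \<phi>)"
  by (auto simp: transformation_groupoid_def fun_eq_iff)

lemma arrows_eq:
  "Ar = subtopology (prod_topology (discrete_topology (carrier G)) T) {(g, \<phi>). \<phi> \<in> D g}"
  by (simp add: transformation_groupoid_def)

lemma topspace_arrows [simp]: "topspace Ar = {(g, \<phi>). \<phi> \<in> D g}"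
  using action_domain_carrier action_domain_character by (auto simp: arrows_eq)

lemma openin_slice:
  assumes "openin T W" "W \<subseteq> D g"
  shows "openin Ar ({g} \<times> W)"
\<comment> \<open>A point of \<open>W\<close> is what shows that \<open>g\<close> belongs to the
  group; without one the slice is empty.\<close>
proof (cases "W = {}")
  case False
  then have "g \<in> carrier G" using assms(2) action_domain_carrier by blast
  then have "openin (prod_topology (discrete_topology (carrier G)) T) ({g} \<times> W)"
    using assms(1) by (simp add: openin_prod_Times_iff)
  moreover have "{g} \<times> W = ({g} \<times> W) \<inter> {(g, \<phi>). \<phi> \<in> D g}" using assms(2) by auto
  ultimately show ?thesis unfolding arrows_eq openin_subtopology by blast
qed simp

text \<open>The group is discrete, so a set of arrows is assembled from its slices over single group
  elements.\<close>

lemma openin_arrows: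
  assumes "U \<subseteq> topspace Ar" "\<And>g. openin T {\<phi> \<in> D g. (g, \<phi>) \<in> U}"
  shows "openin Ar U"
proof -
  have "U = (\<Union>g. {g} \<times> {\<phi> \<in> D g. (g, \<phi>) \<in> U})" using assms(1) by auto
  moreover have "openin Ar (\<Union>g. {g} \<times> {\<phi> \<in> D g. (g, \<phi>) \<in> U})"
    using assms(2) by (intro openin_Union) (auto intro: openin_slice)
  ultimately show ?thesis by simp
qed

lemma openin_arrow_set:
  "openin (prod_topology (discrete_topology (carrier G)) T) {(g, \<phi>). \<phi> \<in> D g}"
proof -
  have "{(g, \<phi>). \<phi> \<in> D g} = (\<Union>g \<in> carrier G. {g} \<times> D g)"
    using action_domain_carrier by auto
  moreover have "openin (prod_topology (discrete_topology (carrier G)) T) (\<Union>g \<in> carrier G. {g} \<times> D g)"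
    by (intro openin_Union) (auto simp: openin_prod_Times_iff openin_action_domain)
  ultimately show ?thesis by simp
qed

text \<open>By the same decomposition into slices, the group part may be held fixed when continuity
  is tested.\<close>

lemma continuous_map_from_arrows:
  assumes "\<And>g. continuous_map (subtopology T (D g)) Z (\<lambda>\<phi>. f (g, \<phi>))"
  shows "continuous_map Ar Z f"
  unfolding continuous_map_def
proof (intro conjI allI impI)
  show "f \<in> topspace Ar \<rightarrow> topspace Z"
    using continuous_map_funspace[OF assms] unfolding topspace_action_domain topspace_arrows
    by (auto simp: Pi_iff)
  fix U assume U: "openin Z U"
  show "openin Ar {x \<in> topspace Ar. f x \<in> U}"
  proof (rule openin_arrows)
    fix g
    have "openin (subtopology T (D g)) {\<phi> \<in> topspace (subtopology T (D g)). f (g, \<phi>) \<in> U}"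
      using assms U by (rule openin_continuous_map_preimage)
    then show "openin T {\<phi> \<in> D g. (g, \<phi>) \<in> {x \<in> topspace Ar. f x \<in> U}}"
      unfolding topspace_action_domain by (simp add: openin_open_subtopology openin_action_domain)
  qed auto
qed

lemma continuous_map_into_arrows:
  assumes "continuous_map Z (discrete_topology (carrier G)) \<gamma>" "continuous_map Z T f"
    and "\<And>z. z \<in> topspace Z \<Longrightarrow> f z \<in> D (\<gamma> z)"
  shows "continuous_map Z Ar (\<lambda>z. (\<gamma> z, f z))"
  unfolding arrows_eq
  using assms by (intro continuous_map_into_subtopology continuous_map_pairedI) auto

lemma continuous_map_slice:
  assumes "g \<in> carrier G" "continuous_map Z T f" "\<And>z. z \<in> topspace Z \<Longrightarrow> f z \<in> D g"
  shows "continuous_map Z Ar (\<lambda>z. (g, f z))"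
  using assms by (intro continuous_map_into_arrows) auto

section \<open>Source and range as local homeomorphisms, and continuity of composition\<close>

lemma continuous_map_source: "continuous_map Ar T snd"
  by (rule continuous_map_from_arrows) (simp add: continuous_map_from_subtopology)

lemma continuous_map_range: "continuous_map Ar T (range_map Gr)"
  by (rule continuous_map_from_arrows) (simp add: continuous_map_action)

lemma image_action_domain: "g \<in> carrier G \<Longrightarrow> act g ` D g = D (inv g)"
  using action_domain_inverse action_inverse' by (auto intro!: image_eqI)

text \<open>On the open slice of arrows with group part \<open>g\<close>, the source is inverted by
  attaching \<open>g\<close> to a character.\<close>

lemma source_local_homeomorphism: "local_homeomorphism Ar T snd"
  unfolding local_homeomorphism_def
proof (intro ballI exI conjI)
  fix x assume "x \<in> topspace Ar"
  then obtain g \<phi> where x: "x = (g, \<phi>)" "\<phi> \<in> D g" by auto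
  let ?U = "{fst x} \<times> D (fst x)"
  show "openin Ar ?U" by (simp add: openin_slice openin_action_domain)
  show "x \<in> ?U" using x by simp
  have im: "snd ` ?U = D (fst x)" by force
  show "openin T (snd ` ?U)" unfolding im by (rule openin_action_domain)
  have "homeomorphic_maps (subtopology Ar ?U) (subtopology T (D g)) snd (\<lambda>\<phi>. (g, \<phi>))"
    unfolding homeomorphic_maps_def
  proof (intro conjI)
    show "continuous_map (subtopology Ar ?U) (subtopology T (D g)) snd"
      using x by (intro continuous_map_into_subtopology continuous_map_from_subtopology
          continuous_map_source) auto
    show "continuous_map (subtopology T (D g)) (subtopology Ar ?U) (\<lambda>\<phi>. (g, \<phi>))"
      using x action_domain_carrier
      by (intro continuous_map_into_subtopology continuous_map_slice)
        (auto simp: continuous_map_from_subtopology)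
  qed (use x in auto)
  then show "homeomorphic_map (subtopology Ar ?U) (subtopology T (snd ` ?U)) snd"
    using x unfolding im by (auto intro: homeomorphic_maps_imp_map)
qed

text \<open>On the slice of \<open>g\<close> the range map is \<open>act g\<close>, a bijection onto
  \<open>D (inv g)\<close>. Its inverse applies \<open>act (inv g)\<close> and attaches
  \<open>g\<close>.\<close>

lemma range_local_homeomorphism: "local_homeomorphism Ar T (range_map Gr)"
  unfolding local_homeomorphism_def
proof (intro ballI exI conjI)
  fix x assume "x \<in> topspace Ar"
  then obtain g \<phi> where x: "x = (g, \<phi>)" "\<phi> \<in> D g" by auto
  then have g: "g \<in> carrier G" using action_domain_carrier by blast
  let ?U = "{fst x} \<times> D (fst x)"
  show "openin Ar ?U" by (simp add: openin_slice openin_action_domain)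
  show "x \<in> ?U" using x by simp
  have "range_map Gr ` ?U = act g ` D g" using x by force
  then have im: "range_map Gr ` ?U = D (inv g)" by (simp add: image_action_domain g)
  show "openin T (range_map Gr ` ?U)" unfolding im by (rule openin_action_domain)
  have "homeomorphic_maps (subtopology Ar ?U) (subtopology T (D (inv g)))
      (range_map Gr) (\<lambda>\<phi>. (g, act (inv g) \<phi>))"
    unfolding homeomorphic_maps_def
  proof (intro conjI)
    show "continuous_map (subtopology Ar ?U) (subtopology T (D (inv g))) (range_map Gr)"
      using x action_domain_inverse
      by (intro continuous_map_into_subtopology continuous_map_from_subtopology
          continuous_map_range) auto
    show "continuous_map (subtopology T (D (inv g))) (subtopology Ar ?U) (\<lambda>\<phi>. (g, act (inv g) \<phi>))"
      using x g action_inverse'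
      by (intro continuous_map_into_subtopology continuous_map_slice continuous_map_action) auto
  qed (use x g action_inverse action_inverse' in auto)
  then show "homeomorphic_map (subtopology Ar ?U) (subtopology T (range_map Gr ` ?U)) (range_map Gr)"
    unfolding im by (rule homeomorphic_maps_imp_map)
qed

text \<open>A composite consists of the product of the two group parts and the source of the second
  arrow. The first depends continuously on the pair because the group is discrete, the second
  because the source map is continuous.\<close>

lemma continuous_map_compose_arrows:
  "continuous_map (subtopology (prod_topology Ar Ar) {(x, y). source Gr x = range_map Gr y}) Ar
     (\<lambda>(x, y). compose_arrows Gr x y)"
proof -
  let ?C = "subtopology (prod_topology Ar Ar) {(x, y). source Gr x = range_map Gr y}"
  let ?dG = "discrete_topology (carrier G)"
  have fst: "continuous_map Ar ?dG fst"
    unfolding arrows_eq by (intro continuous_map_from_subtopology continuous_map_fst)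
  have "continuous_map (prod_topology Ar Ar) ?dG (fst \<circ> fst)"
    "continuous_map (prod_topology Ar Ar) ?dG (fst \<circ> snd)"
    by (rule continuous_map_compose[OF _ fst], simp add: continuous_map_fst continuous_map_snd)+
  then have "continuous_map (prod_topology Ar Ar) (prod_topology ?dG ?dG)
      (\<lambda>z. (fst (fst z), fst (snd z)))"
    by (intro continuous_map_pairedI) (simp_all add: o_def)
  then have "continuous_map (prod_topology Ar Ar) ?dG ((\<lambda>(g, h). g \<otimes> h) \<circ> (\<lambda>z. (fst (fst z), fst (snd z))))"
    by (rule continuous_map_compose) (auto simp flip: prod_topology_discrete_topology)
  then have 1: "continuous_map ?C ?dG (\<lambda>z. fst (fst z) \<otimes> fst (snd z))"
    by (intro continuous_map_from_subtopology) (simp add: o_def)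
  have "continuous_map (prod_topology Ar Ar) T (snd \<circ> snd)"
    by (rule continuous_map_compose[OF continuous_map_snd continuous_map_source])
  then have 2: "continuous_map ?C T (\<lambda>z. snd (snd z))"
    by (intro continuous_map_from_subtopology) (simp add: o_def)
  have "continuous_map ?C Ar (\<lambda>z. (fst (fst z) \<otimes> fst (snd z), snd (snd z)))"
    by (rule continuous_map_into_arrows[OF 1 2]) (auto intro: action_domain_comp)
  moreover have "(\<lambda>(x, y). compose_arrows Gr x y) = (\<lambda>z. (fst (fst z) \<otimes> fst (snd z), snd (snd z)))"
    by (auto simp: fun_eq_iff)
  ultimately show ?thesis by simp
qed

section \<open>Separation, local compactness and the etale axioms\<close>

lemma Hausdorff_arrows: "Hausdorff_space Ar"
  unfolding arrows_eq
  by (intro Hausdorff_space_subtopology)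
    (simp add: Hausdorff_space_prod_topology Hausdorff_spectrum)

text \<open>The arrows form an open subset of the product of a discrete space with a compact
  Hausdorff space.\<close>

lemma locally_compact_arrows: "locally_compact_space Ar"
  unfolding arrows_eq
proof (rule locally_compact_space_open_subset)
  show "openin (prod_topology (discrete_topology (carrier G)) T) {(g, \<phi>). \<phi> \<in> D g}"
    by (rule openin_arrow_set)
  show "locally_compact_space (prod_topology (discrete_topology (carrier G)) T)"
    by (simp add: locally_compact_space_prod_topology locally_compact_space_discrete_topology
        compact_imp_locally_compact_space compact_spectrum)
  show "Hausdorff_space (prod_topology (discrete_topology (carrier G)) T) \<or>
    regular_space (prod_topology (discrete_topology (carrier G)) T)"
    by (simp add: Hausdorff_space_prod_topology Hausdorff_spectrum)
qed

theorem etale_transformation_groupoid: "etale_groupoid Gr"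
proof
  show "continuous_map Ar Ar (inverse_arrow Gr)"
  proof (rule continuous_map_from_arrows)
    fix g
    show "continuous_map (subtopology T (D g)) Ar (\<lambda>\<phi>. inverse_arrow Gr (g, \<phi>))"
    proof (cases "g \<in> carrier G")
      case True
      have "continuous_map (subtopology T (D g)) Ar (\<lambda>\<phi>. (inv g, act g \<phi>))"
        using True action_domain_inverse
        by (intro continuous_map_slice continuous_map_action) auto
      then show ?thesis by simp
    next
      case False
      then have "D g = {}" using action_domain_carrier by blast
      then show ?thesis by simp
    qed
  qed
  show "continuous_map (unit_space Gr) Ar (unit_arrow Gr)"
  proof -
    have "unit_arrow Gr = (\<lambda>\<phi>. (\<one>, \<phi>))" by (simp add: fun_eq_iff)
    then show ?thesis
      using continuous_map_slice[OF one_closed, of T "\<lambda>\<phi>. \<phi>"] by (simp add: action_domain_one)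
  qed
qed (use continuous_map_compose_arrows source_local_homeomorphism range_local_homeomorphism
    in \<open>auto simp: action_domain_character action_character action_domain_one action_one
      action_domain_comp action_comp m_assoc action_domain_carrier action_domain_inverse
      action_inverse Hausdorff_arrows locally_compact_arrows\<close>)

section \<open>Compact open bisections from elements of \<open>P\<close>, and a criterion for pure
  infiniteness\<close>

lemma compact_open_slice:
  assumes "compact_open T A" "p \<in> P"
  shows "compact_open Ar ({p} \<times> A)" "bisection Gr ({p} \<times> A)"
proof -
  have A: "compactin T A" "openin T A" "A \<subseteq> \<Omega>"
    using assms(1) openin_subset by (fastforce simp: compact_open_def)+
  then have D: "A \<subseteq> D p" using action_translation(1) assms(2) by blast
  \<comment> \<open>This section of the source is defined on the whole spectrum, so it carries the
    compact set \<open>A\<close> to a compact slice.\<close>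
  have "continuous_map T Ar (\<lambda>\<phi>. (p, \<phi>))"
    using action_translation(1) assms(2) P_carrier by (intro continuous_map_slice) auto
  then have "compactin Ar ((\<lambda>\<phi>. (p, \<phi>)) ` A)" using A(1) image_compactin by blast
  moreover have "(\<lambda>\<phi>. (p, \<phi>)) ` A = {p} \<times> A" by auto
  ultimately show "compact_open Ar ({p} \<times> A)"
    using openin_slice[OF A(2) D] by (simp add: compact_open_def)
  have "inj_on (act p) A" using D action_inverse by (intro inj_on_inverseI[of _ "act (inv p)"]) blast
  then show "bisection Gr ({p} \<times> A)"
    using D by (auto simp: bisection_def inj_on_def)
qed

text \<open>A translation whose preimage map fixes the finitely many ideals that describe a compact open
  set maps this set into itself.\<close>

theorem purely_infinite_transformation_groupoidI:
  assumes "\<And>F. finite F \<Longrightarrow> F \<subseteq> J \<Longrightarrow>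
    \<exists>p \<in> P. \<exists>q \<in> P. left_translate G p P \<inter> left_translate G q P = {} \<and>
      (\<forall>X \<in> F. left_preimage G P p X = X \<and> left_preimage G P q X = X)"
  shows "purely_infinite Gr"
  unfolding purely_infinite_def
proof (intro conjI allI impI)
  show "etale_groupoid Gr" by (rule etale_transformation_groupoid)
  show "totally_disconnected (unit_space Gr)" by (simp add: totally_disconnected_spectrum)
  fix A assume "compact_open (unit_space Gr) A"
  then have A: "compact_open T A" by simp
  then have sub: "A \<subseteq> \<Omega>" using openin_subset by (fastforce simp: compact_open_def)
  obtain F where F: "finite F" "F \<subseteq> J"
    "\<And>\<phi> \<psi>. \<phi> \<in> A \<Longrightarrow> \<psi> \<in> \<Omega> \<Longrightarrow> (\<And>X. X \<in> F \<Longrightarrow> \<psi> X = \<phi> X) \<Longrightarrow> \<psi> \<in> A"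
    using compact_open_finite_support[OF A] by metis
  obtain p q where pq: "p \<in> P" "q \<in> P" "left_translate G p P \<inter> left_translate G q P = {}"
    "\<And>X. X \<in> F \<Longrightarrow> left_preimage G P p X = X" "\<And>X. X \<in> F \<Longrightarrow> left_preimage G P q X = X"
    using assms[OF F(1,2)] by metis
  \<comment> \<open>When \<open>r\<close> fixes the ideals in \<open>F\<close>, the characters
    \<open>act r \<phi>\<close> and \<phi> agree on \<open>F\<close>, and this agreement keeps
    \<open>act r \<phi>\<close> in \<open>A\<close>.\<close>
  have into: "act r \<phi> \<in> A"
    if "r \<in> P" "\<And>X. X \<in> F \<Longrightarrow> left_preimage G P r X = X" "\<phi> \<in> A" for r \<phi>
  proof (rule F(3)[OF that(3)])
    have \<phi>: "\<phi> \<in> \<Omega>" using that(3) sub by (rule rev_subsetD)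
    show "act r \<phi> \<in> \<Omega>"
      by (intro action_character action_translation(1) \<phi> that(1))
    fix X assume X: "X \<in> F"
    have "act r \<phi> X = \<phi> (left_preimage G P r X)"
      by (rule action_translation(2)[OF \<phi> that(1) subsetD[OF F(2) X]])
    then show "act r \<phi> X = \<phi> X" unfolding that(2)[OF X] .
  qed
  have ideal: "left_translate G r P \<in> J" if "r \<in> P" for r
    by (rule translate_in_J[OF constructible_ideals.whole that])
  \<comment> \<open>The right ideal \<open>rP\<close> pulls back along \<open>r\<close> to
    \<open>P\<close>, so every character in the image of \<open>act r\<close> is 1 there.\<close>
  have one: "act r \<phi> (left_translate G r P) = 1" if "r \<in> P" "\<phi> \<in> \<Omega>" for r \<phi>
  proof -
    have "left_preimage G P r (left_translate G r P) = P"
      by (auto simp: left_preimage_def left_translate_def)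
    then show ?thesis
      using action_translation(2)[OF that(2,1) ideal[OF that(1)]] character_P[OF that(2)] by simp
  qed
  \<comment> \<open>A common image would be 1 at both \<open>pP\<close> and \<open>qP\<close>, hence
    at their intersection, which is empty.\<close>
  have disj: "act p \<phi> \<noteq> act q \<psi>" if "\<phi> \<in> A" "\<psi> \<in> A" for \<phi> \<psi>
  proof
    assume eq: "act p \<phi> = act q \<psi>"
    have "act p \<phi> \<in> \<Omega>" using into[OF pq(1,4) that(1)] sub by blast
    then have "act p \<phi> (left_translate G p P \<inter> left_translate G q P) = 1 * 1"
      using one[OF pq(1), of \<phi>] one[OF pq(2), of \<psi>] that sub eq
      by (subst character_mult) (auto simp: ideal pq)
    then show False using character_empty[OF \<open>act p \<phi> \<in> \<Omega>\<close>] pq(3) by simp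
  qed
  show "\<exists>U V. compact_open Ar U \<and> bisection Gr U \<and> compact_open Ar V \<and> bisection Gr V \<and>
      source Gr ` U = A \<and> source Gr ` V = A \<and> range_map Gr ` U \<union> range_map Gr ` V \<subseteq> A \<and>
      range_map Gr ` U \<inter> range_map Gr ` V = {}"
  proof (intro exI conjI)
    show "compact_open Ar ({p} \<times> A)" "bisection Gr ({p} \<times> A)"
      "compact_open Ar ({q} \<times> A)" "bisection Gr ({q} \<times> A)"
      using compact_open_slice[OF A] pq by simp_all
    show "source Gr ` ({p} \<times> A) = A" "source Gr ` ({q} \<times> A) = A" by force+
    show "range_map Gr ` ({p} \<times> A) \<union> range_map Gr ` ({q} \<times> A) \<subseteq> A"
      using into pq by auto
    show "range_map Gr ` ({p} \<times> A) \<inter> range_map Gr ` ({q} \<times> A) = {}"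
      using disj by fastforce
  qed
qed

end

section \<open>Ideals of an integral domain\<close>

text \<open>Negatives are multiples by \<open>- 1\<close>, and commutativity turns left multiples
  into two-sided ones.\<close>

lemma ideal_ring_of_class_iff:
  fixes I :: "'a::comm_ring_1 set"
  shows "ideal I ring_of_class \<longleftrightarrow>
    0 \<in> I \<and> (\<forall>x \<in> I. \<forall>y \<in> I. x + y \<in> I) \<and> (\<forall>r. \<forall>x \<in> I. r * x \<in> I)" (is "_ \<longleftrightarrow> ?R")
proof
  assume "ideal I ring_of_class"
  then interpret ideal I "ring_of_class :: 'a ring" .
  show ?R
    using additive_subgroup.zero_closed[OF is_additive_subgroup]
      additive_subgroup.a_closed[OF is_additive_subgroup] I_l_closed
    by (auto simp: ring_of_class_def)
next
  assume R: ?R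
  interpret cring "ring_of_class :: 'a ring" by (rule cring_ring_of_class)
  have inv: "a_inv ring_of_class x = - x" for x :: 'a
    by (rule minus_equality) (auto simp: ring_of_class_def)
  have "- x \<in> I" if "x \<in> I" for x using R that by (metis mult_minus1)
  then have "subgroup I (add_monoid ring_of_class)"
    using R inv by (intro add.subgroupI) (auto simp: ring_of_class_def a_inv_def)
  moreover have "x * y \<in> I" if "x \<in> I" for x y using R that by (metis mult.commute)
  ultimately show "ideal I ring_of_class"
    using R by (intro idealI ring_axioms) (auto simp: ring_of_class_def)
qed

text \<open>An element outside a maximal ideal \<open>M\<close> is invertible modulo \<open>M\<close>, so \<open>M\<close> meets \<open>1 + aR\<close>; adding
  a nonzero multiple of \<open>a\<close> from \<open>M\<close> avoids \<open>0\<close>.\<close>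

lemma exists_nonunit_in_coset:
  fixes a :: "'a::idom"
  assumes "(jacobson_radical :: 'a set) = {0}" "{a :: 'a. a \<noteq> 0} \<noteq> {a. a dvd 1}" "a \<noteq> 0"
  obtains r where "1 + r * a \<noteq> 0" "\<not> (1 + r * a) dvd 1"
proof -
  \<comment> \<open>As the radical is zero, some maximal ideal misses the nonzero element
    \<open>a\<close>.\<close>
  obtain M where M: "maximalideal M ring_of_class" "a \<notin> M"
    using assms(1,3) unfolding jacobson_radical_def by blast
  have "ideal M ring_of_class" using M(1) by (rule maximalideal.axioms)
  then have M0: "0 \<in> M" and Madd: "\<And>x y. x \<in> M \<Longrightarrow> y \<in> M \<Longrightarrow> x + y \<in> M"
    and Mmult: "\<And>r x. x \<in> M \<Longrightarrow> r * x \<in> M"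
    by (auto simp: ideal_ring_of_class_iff)
  have maximal: "N = M \<or> N = UNIV" if "ideal N ring_of_class" "M \<subseteq> N" for N
    using maximalideal.I_maximal[OF M(1) that] by (simp add: ring_of_class_def)
  have proper: "1 \<notin> M"
  proof
    assume "1 \<in> M"
    then have "x \<in> M" for x using Mmult[of 1 x] by simp
    then show False using M(2) by blast
  qed
  \<comment> \<open>This is the ideal \<open>M + aR\<close>. It contains \<open>a\<close>, so it is
    strictly larger than \<open>M\<close> and must contain 1.\<close>
  define N where "N = {x + s * a | x s. x \<in> M}"
  have NI: "x + s * a \<in> N" if "x \<in> M" for x s using that by (auto simp: N_def)
  have "ideal N ring_of_class"
    unfolding ideal_ring_of_class_iff
  proof (intro conjI ballI allI)
    show "0 \<in> N" using NI[OF M0, of 0] by simp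
    fix y assume "y \<in> N"
    then obtain x s where y: "y = x + s * a" "x \<in> M" by (auto simp: N_def)
    show "r * y \<in> N" for r
      using NI[OF Mmult[OF y(2), of r], of "r * s"] by (simp add: y(1) algebra_simps)
    fix z assume "z \<in> N"
    then obtain x' s' where z: "z = x' + s' * a" "x' \<in> M" by (auto simp: N_def)
    then show "y + z \<in> N"
      using NI[OF Madd[OF y(2) z(2)], of "s + s'"] by (simp add: y(1) algebra_simps)
  qed
  moreover have "M \<subseteq> N" using NI[of _ 0] by auto
  moreover have "a \<in> N" using NI[OF M0, of 1] by simp
  ultimately have "1 \<in> N" using maximal M(2) by blast
  then obtain x s where xs: "1 = x + s * a" "x \<in> M" by (auto simp: N_def)
  obtain m where m: "m \<in> M" "m \<noteq> 0"
  proof -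
    obtain u :: 'a where u: "u \<noteq> 0" "\<not> u dvd 1"
      using assms(2) by auto
    have "ideal {y. u dvd y} ring_of_class"
      by (simp add: ideal_ring_of_class_iff)
    \<comment> \<open>If \<open>M\<close> were zero, the ideal of multiples of the nonzero nonunit
      \<open>u\<close> would lie strictly between \<open>M\<close> and the ring.\<close>
    have "\<not> M \<subseteq> {0}"
    proof
      assume M: "M \<subseteq> {0}"
      then have "M \<subseteq> {y. u dvd y}" by auto
      with \<open>ideal {y. u dvd y} ring_of_class\<close> have "{y. u dvd y} = M \<or> {y. u dvd y} = UNIV"
        by (rule maximal)
      moreover have "u \<in> {y. u dvd y}" "1 \<notin> {y. u dvd y}" using u by auto
      ultimately show False using M u(1) by blast
    qed
    then show thesis using that M0 by blast
  qed
  have in_M: "\<not> y dvd 1" if "y \<in> M" for y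
    using proper Mmult[OF that] by (metis dvdE mult.commute)
  have x: "x = 1 + (- s) * a" using xs(1) by (simp add: algebra_simps)
  show thesis
  proof (cases "x = 0")
    case False
    then show ?thesis using that[of "- s"] in_M xs(2) x by simp
  next
    case True
    have "x + m * a = 1 + (m - s) * a" unfolding x by (simp add: algebra_simps)
    moreover have "x + m * a \<noteq> 0" using True m(2) assms(3) by simp
    moreover have "x + m * a \<in> M" using Madd xs(2) Mmult[OF m(1), of a] by (simp add: mult.commute)
    ultimately show ?thesis using that[of "m - s"] in_M by metis
  qed
qed

section \<open>Constructible ideals of the \<open>ax + b\<close>-semigroup\<close>

text \<open>Moves computations with fractions of denominator 1 to pairs over \<open>R\<close>. A
  zero second entry is allowed, so the range is larger than \<open>axb_semigroup\<close>.\<close>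

definition axb_embed :: "'a::idom \<times> 'a \<Rightarrow> 'a fract \<times> 'a fract" where
  "axb_embed = (\<lambda>(b, a). (Fraction_Field.Fract b 1, Fraction_Field.Fract a 1))"

text \<open>The right ideal \<open>(b + I) \<times> I\<^sup>\<times>\<close>.\<close>

definition coset_ideal :: "'a::idom \<Rightarrow> 'a set \<Rightarrow> ('a fract \<times> 'a fract) set" where
  "coset_ideal b I = axb_embed ` {(x, z). x - b \<in> I \<and> z \<in> I \<and> z \<noteq> 0}"

lemma axb_embed_eq_iff [simp]: "axb_embed x = axb_embed y \<longleftrightarrow> x = y"
  by (auto simp: axb_embed_def Fraction_Field.eq_fract split: prod.splits)

lemma axb_embed_mult [simp]: "axb_embed (b, a) \<otimes>\<^bsub>axb_group\<^esub> axb_embed (d, c) = axb_embed (b + a * d, a * c)"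
  by (simp add: axb_embed_def axb_group_def)

lemma axb_semigroup_eq: "axb_semigroup = axb_embed ` {(b, a). a \<noteq> 0}"
  by (auto simp: axb_semigroup_def axb_embed_def)

lemma axb_embed_in_axb_semigroup [simp]: "axb_embed (b, a) \<in> axb_semigroup \<longleftrightarrow> a \<noteq> 0"
  by (auto simp: axb_semigroup_eq)

lemma axb_embed_in_coset_ideal [simp]:
  "axb_embed (x, z) \<in> coset_ideal b I \<longleftrightarrow> x - b \<in> I \<and> z \<in> I \<and> z \<noteq> 0"
  by (auto simp: coset_ideal_def)

lemma axb_set_eqI:
  assumes "A \<subseteq> Set.range axb_embed" "B \<subseteq> Set.range axb_embed"
    and "\<And>x z. axb_embed (x, z) \<in> A \<longleftrightarrow> axb_embed (x, z) \<in> B"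
  shows "A = B"
proof (rule Set.set_eqI)
  fix y
  show "y \<in> A \<longleftrightarrow> y \<in> B"
  proof (cases "y \<in> Set.range axb_embed")
    case True
    then obtain w where "y = axb_embed w" by blast
    then show ?thesis using assms(3)[of "fst w" "snd w"] by simp
  next
    case False
    then show ?thesis using assms(1,2) by blast
  qed
qed

lemma axb_embed_in_left_translate:
  "axb_embed (x, z) \<in> left_translate axb_group (axb_embed (d, c)) (coset_ideal b I) \<longleftrightarrow>
    (\<exists>x' z'. x = d + c * x' \<and> z = c * z' \<and> x' - b \<in> I \<and> z' \<in> I \<and> z' \<noteq> 0)" (is "?L \<longleftrightarrow> ?R")
proof
  assume ?L
  then obtain y where y: "axb_embed (x, z) = axb_embed (d, c) \<otimes>\<^bsub>axb_group\<^esub> y" "y \<in> coset_ideal b I"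
    unfolding left_translate_def by blast
  obtain x' z' where "y = axb_embed (x', z')" "x' - b \<in> I" "z' \<in> I" "z' \<noteq> 0"
    using y(2) unfolding coset_ideal_def by blast
  then show ?R using y(1) by auto
next
  assume ?R
  then obtain x' z' where "axb_embed (x, z) = axb_embed (d, c) \<otimes>\<^bsub>axb_group\<^esub> axb_embed (x', z')"
    "axb_embed (x', z') \<in> coset_ideal b I" by auto
  then show ?L unfolding left_translate_def by blast
qed

text \<open>Induction on the construction. One step imposes an affine equation on the first entry
  and its homogeneous version on the second. If the affine equation is solvable, its solutions form
  a coset of the ideal of all \<open>z\<close> with \<open>a * z\<close> in \<open>c * I\<close>;
  otherwise the result is empty. The nonzero element is recorded for the later choice of a common
  element.\<close>

lemma constructible_ideal_axb:
  fixes X :: "('a::idom fract \<times> 'a fract) set"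
  assumes "X \<in> constructible_ideals axb_group axb_semigroup" "X \<noteq> {}"
  obtains b I a where "ideal I ring_of_class" "a \<in> I" "a \<noteq> 0" "X = coset_ideal b I"
proof -
  have "X = {} \<or> (\<exists>b I. ideal I ring_of_class \<and> (\<exists>a \<in> I. a \<noteq> 0) \<and> X = coset_ideal b I)"
    using assms(1)
  proof induction
    case empty
    then show ?case by simp
  next
    case whole
    have "ideal (UNIV :: 'a set) ring_of_class" by (simp add: ideal_ring_of_class_iff)
    moreover have "axb_semigroup = coset_ideal 0 (UNIV :: 'a set)"
      by (simp add: axb_semigroup_eq coset_ideal_def)
    ultimately show ?case by (metis UNIV_I zero_neq_one)
  next
    case (step X p q)
    obtain d a where p: "p = axb_embed (d, a)" "a \<noteq> 0" using step(2) by (auto simp: axb_semigroup_eq)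
    obtain d' c where q: "q = axb_embed (d', c)" "c \<noteq> 0" using step(3) by (auto simp: axb_semigroup_eq)
    let ?Y = "left_preimage axb_group axb_semigroup p (left_translate axb_group q X)"
    show ?case
    proof (cases "?Y = {}")
      case False
      then have "X \<noteq> {}" by (auto simp: left_preimage_def left_translate_def)
      then obtain b I i where I: "ideal I ring_of_class" "i \<in> I" "i \<noteq> 0" "X = coset_ideal b I"
        using step.IH by blast
      then have I0: "0 \<in> I" and Iadd: "\<And>x y. x \<in> I \<Longrightarrow> y \<in> I \<Longrightarrow> x + y \<in> I"
        and Imult: "\<And>r x. x \<in> I \<Longrightarrow> r * x \<in> I"
        by (auto simp: ideal_ring_of_class_iff)
      have Idiff: "x - y \<in> I" if "x \<in> I" "y \<in> I" for x y
        using Iadd[OF that(1) Imult[OF that(2), of "- 1"]] by simp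
      \<comment> \<open>That \<open>z'\<close> is nonzero follows from
        \<open>a * z = c * z'\<close>, since \<open>a\<close> and \<open>z\<close> are nonzero in a
        domain.\<close>
      have Y: "axb_embed (x, z) \<in> ?Y \<longleftrightarrow> z \<noteq> 0 \<and>
          (\<exists>x'. d + a * x = d' + c * x' \<and> x' - b \<in> I) \<and> (\<exists>z' \<in> I. a * z = c * z')" for x z
        using p q by (auto simp: left_preimage_def axb_embed_in_left_translate I(4))
      have subset_range: "?Y \<subseteq> Set.range axb_embed"
        by (auto simp: left_preimage_def axb_semigroup_eq)
      obtain w where "axb_embed w \<in> ?Y"
        using False subset_range by blast
      then obtain x\<^sub>0 z\<^sub>0 where "axb_embed (x\<^sub>0, z\<^sub>0) \<in> ?Y"
        by (cases w) blast
      \<comment> \<open>The chosen point of the nonempty set solves the affine equation; it serves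
        as base point of the new coset.\<close>
      then obtain x\<^sub>1 where x1: "d + a * x\<^sub>0 = d' + c * x\<^sub>1" "x\<^sub>1 - b \<in> I" using Y by blast
      define L where "L = {z. \<exists>z' \<in> I. a * z = c * z'}"
      have "ideal L ring_of_class"
        unfolding ideal_ring_of_class_iff L_def
      proof (intro conjI ballI allI)
        show "0 \<in> {z. \<exists>z' \<in> I. a * z = c * z'}" using I0 by (auto intro: bexI[of _ 0])
        fix y assume "y \<in> {z. \<exists>z' \<in> I. a * z = c * z'}"
        then obtain y' where y: "y' \<in> I" "a * y = c * y'" by blast
        show "r * y \<in> {z. \<exists>z' \<in> I. a * z = c * z'}" for r
          using y Imult[of y' r] by (auto intro!: bexI[of _ "r * y'"] simp: mult.left_commute)
        fix z assume "z \<in> {z. \<exists>z' \<in> I. a * z = c * z'}"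
        then obtain z' where "z' \<in> I" "a * z = c * z'" by blast
        then show "y + z \<in> {z. \<exists>z' \<in> I. a * z = c * z'}"
          using y Iadd by (auto intro!: bexI[of _ "y' + z'"] simp: distrib_left)
      qed
      \<comment> \<open>Here \<open>a * (c * i) = c * (a * i)\<close> with \<open>a * i\<close> in
        \<open>I\<close>, so the new ideal is again nonzero.\<close>
      moreover have "c * i \<in> L" "c * i \<noteq> 0"
        using Imult[OF I(2), of a] I(3) q(2) by (auto simp: L_def intro!: bexI[of _ "a * i"])
      moreover have "?Y = coset_ideal x\<^sub>0 L"
      proof -
        have "axb_embed (x, z) \<in> ?Y \<longleftrightarrow> axb_embed (x, z) \<in> coset_ideal x\<^sub>0 L" for x z
        proof -
          \<comment> \<open>Subtracting the equation of the base point leaves the homogeneous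
            equation, because \<open>x'\<close> and \<open>x\<^sub>1\<close> lie in the same coset
            \<open>b + I\<close>.\<close>
          have "(\<exists>x'. d + a * x = d' + c * x' \<and> x' - b \<in> I) \<longleftrightarrow> x - x\<^sub>0 \<in> L"
          proof
            assume "\<exists>x'. d + a * x = d' + c * x' \<and> x' - b \<in> I"
            then obtain x' where x': "d + a * x = d' + c * x'" "x' - b \<in> I" by blast
            have "a * (x - x\<^sub>0) = (d + a * x) - (d + a * x\<^sub>0)" by (simp add: algebra_simps)
            also have "\<dots> = c * (x' - x\<^sub>1)" unfolding x'(1) x1(1) by (simp add: algebra_simps)
            finally have "a * (x - x\<^sub>0) = c * (x' - x\<^sub>1)" .
            moreover have "x' - x\<^sub>1 \<in> I" using Idiff[OF x'(2) x1(2)] by simp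
            ultimately show "x - x\<^sub>0 \<in> L" by (auto simp: L_def)
          next
            assume "x - x\<^sub>0 \<in> L"
            then obtain y where y: "y \<in> I" "a * (x - x\<^sub>0) = c * y" by (auto simp: L_def)
            have "d + a * x = (d + a * x\<^sub>0) + a * (x - x\<^sub>0)" by (simp add: algebra_simps)
            also have "\<dots> = d' + c * (x\<^sub>1 + y)" unfolding y(2) x1(1) by (simp add: algebra_simps)
            finally have "d + a * x = d' + c * (x\<^sub>1 + y)" .
            moreover have "x\<^sub>1 + y - b \<in> I" using Iadd[OF x1(2) y(1)] by (simp add: algebra_simps)
            ultimately show "\<exists>x'. d + a * x = d' + c * x' \<and> x' - b \<in> I" by blast
          qed
          then show ?thesis unfolding Y by (auto simp: L_def)
        qed
        moreover have "coset_ideal x\<^sub>0 L \<subseteq> Set.range axb_embed" by (auto simp: coset_ideal_def)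
        ultimately show ?thesis using subset_range by (intro axb_set_eqI)
      qed
      ultimately show ?thesis by blast
    qed simp
  qed
  then show thesis using assms(2) that by blast
qed

text \<open>A product of nonzero elements, one from each ideal, lies in all the ideals and is
  nonzero in a domain.\<close>

lemma finite_constructible_ideals_common_element:
  fixes F :: "('a::idom fract \<times> 'a fract) set set"
  assumes "finite F" "F \<subseteq> constructible_ideals axb_group axb_semigroup"
  obtains a where "a \<noteq> 0"
    "\<And>X. X \<in> F \<Longrightarrow> X \<noteq> {} \<Longrightarrow> \<exists>b I. ideal I ring_of_class \<and> a \<in> I \<and> X = coset_ideal b I"
proof -
  \<comment> \<open>This property of \<open>a\<close> survives multiplication of \<open>a\<close> by
    ring elements, so the induction can extend the product one factor at a time.\<close>
  define Q :: "'a \<Rightarrow> ('a fract \<times> 'a fract) set \<Rightarrow> bool"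
    where "Q = (\<lambda>a X. \<exists>b I. ideal I ring_of_class \<and> a \<in> I \<and> X = coset_ideal b I)"
  have Q_mult: "Q (r * a) X" if "Q a X" for r a X
  proof -
    obtain b I where I: "ideal I ring_of_class" "a \<in> I" "X = coset_ideal b I"
      using \<open>Q a X\<close> unfolding Q_def by blast
    then have "r * a \<in> I" by (simp add: ideal_ring_of_class_iff)
    then show ?thesis using I(1,3) unfolding Q_def by blast
  qed
  have "\<exists>a. a \<noteq> 0 \<and> (\<forall>X \<in> F. X \<noteq> {} \<longrightarrow> Q a X)"
    using assms
  proof (induction F)
    case empty
    show ?case by (rule exI[of _ 1]) simp
  next
    case (insert X F)
    have F: "F \<subseteq> constructible_ideals axb_group axb_semigroup"
      and X: "X \<in> constructible_ideals axb_group axb_semigroup"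
      using insert.prems by blast+
    obtain a where a: "a \<noteq> 0" "\<forall>X \<in> F. X \<noteq> {} \<longrightarrow> Q a X"
      using insert.IH[OF F] by blast
    show ?case
    proof (cases "X = {}")
      case True
      then show ?thesis using a by blast
    next
      case False
      obtain b I c where I: "ideal I ring_of_class" "c \<in> I" "c \<noteq> 0" "X = coset_ideal b I"
        using X False by (rule constructible_ideal_axb)
      then have "Q c X" unfolding Q_def by blast
      then have QX: "Q (a * c) X" by (rule Q_mult)
      have "Q (a * c) Y" if Y: "Y \<in> insert X F" "Y \<noteq> {}" for Y
      proof (cases "Y = X")
        case True
        then show ?thesis using QX by simp
      next
        case False
        then have "Q a Y" using a(2) Y by simp
        then show ?thesis unfolding mult.commute[of a c] by (rule Q_mult)
      qed
      then show ?thesis using a(1) I(3) by (intro exI[of _ "a * c"] conjI) auto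
    qed
  qed
  then obtain a where a: "a \<noteq> 0" "\<And>X. X \<in> F \<Longrightarrow> X \<noteq> {} \<Longrightarrow> Q a X" by blast
  show thesis by (rule that[OF a(1) a(2)[unfolded Q_def]])
qed

text \<open>Modulo \<open>I\<close>, multiplication by \<open>1 + e\<close> and translation by
  \<open>d\<close> are both the identity. The condition \<open>1 + e \<noteq> 0\<close> keeps
  nonzero second entries nonzero.\<close>

lemma left_preimage_coset_ideal:
  assumes I: "ideal I ring_of_class" "e \<in> I" "d \<in> I" and "1 + e \<noteq> 0"
  shows "left_preimage axb_group axb_semigroup (axb_embed (d, 1 + e)) (coset_ideal b I) = coset_ideal b I"
proof -
  have Iadd: "\<And>x y. x \<in> I \<Longrightarrow> y \<in> I \<Longrightarrow> x + y \<in> I" and Imult: "\<And>r x. x \<in> I \<Longrightarrow> r * x \<in> I"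
    using I(1) by (auto simp: ideal_ring_of_class_iff)
  have add_iff: "x + y \<in> I \<longleftrightarrow> x \<in> I" if "y \<in> I" for x y
    using Iadd[of "x + y" "- 1 * y"] Iadd[of x y] Imult[OF that, of "- 1"] that by auto
  have "d + (1 + e) * x - b \<in> I \<longleftrightarrow> x - b \<in> I" for x
  proof -
    have "d + (1 + e) * x - b = (x - b) + (d + x * e)" by (simp add: algebra_simps)
    moreover have "d + x * e \<in> I" using Iadd Imult I by blast
    ultimately show ?thesis by (simp only: add_iff)
  qed
  moreover have "(1 + e) * z \<in> I \<longleftrightarrow> z \<in> I" for z
    using add_iff[OF Imult[OF I(2), of z], of z] by (simp add: algebra_simps)
  ultimately have "axb_embed (x, z) \<in> left_preimage axb_group axb_semigroup (axb_embed (d, 1 + e)) (coset_ideal b I)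
      \<longleftrightarrow> axb_embed (x, z) \<in> coset_ideal b I" for x z
    using assms(4) by (auto simp: left_preimage_def)
  moreover have "left_preimage axb_group axb_semigroup (axb_embed (d, 1 + e)) (coset_ideal b I) \<subseteq> Set.range axb_embed"
    "coset_ideal b I \<subseteq> Set.range axb_embed"
    by (auto simp: left_preimage_def axb_semigroup_eq coset_ideal_def)
  ultimately show ?thesis by (intro axb_set_eqI)
qed

section \<open>Two translations with disjoint images that fix finitely many given ideals\<close>

theorem theorem4p6:
  assumes "countable (UNIV :: 'a::idom set)"
    and "(jacobson_radical :: 'a set) = {0}"
    and "{a :: 'a. a \<noteq> 0} \<noteq> {a. a dvd 1}"
  shows "purely_infinite (transformation_groupoid
    (axb_group :: ('a fract \<times> 'a fract) monoid) (axb_semigroup :: ('a fract \<times> 'a fract) set))"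
proof (rule subsemigroup_of_group.purely_infinite_transformation_groupoidI[OF axb_subsemigroup])
  fix F :: "('a fract \<times> 'a fract) set set"
  assume F: "finite F" "F \<subseteq> constructible_ideals axb_group axb_semigroup"
  obtain a where a: "a \<noteq> 0"
    "\<And>X. X \<in> F \<Longrightarrow> X \<noteq> {} \<Longrightarrow> \<exists>b I. ideal I ring_of_class \<and> a \<in> I \<and> X = coset_ideal b I"
    using finite_constructible_ideals_common_element[OF F] by metis
  obtain r where r: "1 + r * a \<noteq> 0" "\<not> (1 + r * a) dvd 1"
    using exists_nonunit_in_coset[OF assms(2,3) a(1)] by metis
  define e where "e = r * a"
  \<comment> \<open>The values 0 and \<open>e\<close> of \<open>d\<close> give the two translations.
    Both are multiples of \<open>a\<close>, hence lie in every ideal that occurs.\<close>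
  have fixed: "left_preimage axb_group axb_semigroup (axb_embed (d, 1 + e)) X = X"
    if X: "X \<in> F" and d: "d \<in> {0, e}" for X d
  proof (cases "X = {}")
    case False
    then obtain b I where I: "ideal I ring_of_class" "a \<in> I" "X = coset_ideal b I"
      using a(2)[OF X] by blast
    then have "e \<in> I" "d \<in> I" using d by (auto simp: ideal_ring_of_class_iff e_def)
    then show ?thesis using I r(1) by (simp add: left_preimage_coset_ideal e_def)
  qed (simp add: left_preimage_def)
  have "left_translate axb_group (axb_embed (0, 1 + e)) axb_semigroup \<inter>
      left_translate axb_group (axb_embed (e, 1 + e)) axb_semigroup = {}"
  proof -
    have False if "e + (1 + e) * y = (1 + e) * x" for x y
    proof -
      \<comment> \<open>A common point of the images writes \<open>e\<close> as
        \<open>(1 + e) * (x - y)\<close>. Then \<open>1 = (1 + e) - e\<close> is also a multiple of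
        \<open>1 + e\<close>, against the choice of a nonunit.\<close>
      have "(1 + e) * (1 - x + y) = 1 + e - (1 + e) * x + (1 + e) * y" by (simp add: algebra_simps)
      also have "\<dots> = 1" unfolding that[symmetric] by simp
      finally have "(1 + e) * (1 - x + y) = 1" .
      then have "(1 + e) dvd 1" by (metis dvd_triv_left)
      then show False using r(2) by (simp add: e_def)
    qed
    then show ?thesis by (auto simp: left_translate_def axb_semigroup_eq)
  qed
  then show "\<exists>p \<in> axb_semigroup. \<exists>q \<in> axb_semigroup.
      left_translate axb_group p axb_semigroup \<inter> left_translate axb_group q axb_semigroup = {} \<and>
      (\<forall>X \<in> F. left_preimage axb_group axb_semigroup p X = X \<and>
        left_preimage axb_group axb_semigroup q X = X)"
    using fixed r(1)
    by (intro bexI[of _ "axb_embed (0, 1 + e)"] bexI[of _ "axb_embed (e, 1 + e)"]) (auto simp: e_def)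
qed

end
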